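(* Fix a system $i$, assume $d[j]=1$ for $j\ge2$, let $\lambda[j]$, $j=1,\dots,L$, be the optimal Lagrange multipliers of the communication constraints, and use the certainty-equivalence controller $u^i_k=-L^i_k\hat x^i_{k|k}[L+1]$. For each scheduler $j\in\{1,\dots,L\}$ define the distributed value of information $$\mathbf{dVoI}^i_k[j]=\lambda[j]-(\tilde x^i_{k|k}[j])^\top(A_i^{L+1-j})^\top\Gamma^i_{k+(L+1-j)}A_i^{L+1-j}\tilde x^i_{k|k}[j],$$ and the policy $\delta^{i\star}_k[j]=1$ if $k\le T-(L+1-j)$ and $\mathbf{dVoI}^i_k[j]<0$, and $\delta^{i\star}_k[j]=0$ otherwise. Then this dVoI-based policy outperforms the periodic policy $\bar\pi^i[j]$ ($\delta^i_k[j]=1$ for all $0\le k\le T-1$) for the problem of minimizing $J^i(\mu^\star,\pi^i)+\sum_{j=1}^L\lambda[j]\,\mathbb E[\sum_{k=0}^{T-1}\delta^i_k[j]]$, i.e., it attains a cost no larger than that of the periodic policy.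
   Context: Setting: $N$ systems $x^i_{k+1}=A_ix^i_k+B_iu^i_k+w^i_k$, $y^i_k=C_ix^i_k+v^i_k$ with independent Gaussian noises and independent zero-mean initial state; each loop closed over an $L$-hop network with schedulers $\mathcal S^i[1],\dots,\mathcal S^i[L]$ choosing $\delta^i_k[j]\in\{0,1\}$ and controller $\mathcal C^i$ (decision maker $L+1$); delays $d[1]=0$, $d[j]=1$ for $j\ge2$. Scheduler 1 runs the Kalman filter $\hat x^i_{k|k}[1]=A_i\hat x^i_{k-1|k-1}[1]+B_iu^i_{k-1}+\zeta^i_k$ (innovation $\zeta^i_k$); for $j\ge2$, $\hat x^i_{k|k}[j]=A_i\hat x^i_{k-1|k-1}[j-1]+B_iu^i_{k-1}$ if $\delta^i_{k-1}[j-1]=1$, else $A_i\hat x^i_{k-1|k-1}[j]+B_iu^i_{k-1}$ (control history known to all). Mismatch error $\tilde x^i_{k|k}[j]=\hat x^i_{k|k}[j]-\hat x^i_{k|k}[j+1]$. Cost $J^i=\mathbb E[(x^i_T)^\top\Lambda_ix^i_T+\sum_{k=0}^{T-1}(x^i_k)^\top Q_ix^i_k+(u^i_k)^\top R_iu^i_k]$; communication constraints $\sum_{i=1}^N\mathbb E[\sum_{k=0}^{T-1}\delta^i_k[j]]\le R[j]$. $S^i_k=Q_i+A_i^\top(S^i_{k+1}-S^i_{k+1}B_i(R_i+B_i^\top S^i_{k+1}B_i)^{-1}B_i^\top S^i_{k+1})A_i$, $S^i_T=\Lambda_i$; $L^i_k=(R_i+B_i^\top S^i_{k+1}B_i)^{-1}B_i^\top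 S^i_{k+1}A_i$; $\Gamma^i_k=(L^i_k)^\top(R_i+B_i^\top S^i_{k+1}B_i)L^i_k$. Scheduling policies are restricted to depend only on $\hat x^i_{0|-1}[1]$, innovations and preceding scheduling variables (so they are independent of the control policy). *)

theory Defs
  imports "HOL-Analysis.Analysis" "HOL-Probability.Probability"
begin

primrec mpow :: "real^'n^'n \<Rightarrow> nat \<Rightarrow> real^'n^'n" where
  "mpow A 0 = mat 1"
| "mpow A (Suc n) = A ** mpow A n"

definition psd :: "real^'n^'n \<Rightarrow> bool" where
  "psd P \<longleftrightarrow> transpose P = P \<and> (\<forall>x. 0 \<le> x \<bullet> (P *v x))"

definition pd :: "real^'n^'n \<Rightarrow> bool" where
  "pd P \<longleftrightarrow> transpose P = P \<and> (\<forall>x. x \<noteq> 0 \<longrightarrow> 0 < x \<bullet> (P *v x))"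

section \<open>Zero-mean Gaussian random vectors (Cramer--Wold definition)\<close>

definition gaussian_vec :: "'a measure \<Rightarrow> ('a \<Rightarrow> real^'n) \<Rightarrow> real^'n^'n \<Rightarrow> bool" where
  "gaussian_vec M X Sig \<longleftrightarrow> X \<in> borel_measurable M \<and>
     (\<forall>c. (if c \<bullet> (Sig *v c) = 0 then (AE \<omega> in M. c \<bullet> X \<omega> = 0)
           else distributed M lborel (\<lambda>\<omega>. c \<bullet> X \<omega>)
                  (\<lambda>t. ennreal (normal_density 0 (sqrt (c \<bullet> (Sig *v c))) t))))"

record ('n, 'm, 'p) lqg =
  sA :: "real^'n^'n"
  sB :: "real^'m^'n"
  sC :: "real^'n^'p"
  sQ :: "real^'n^'n"
  sR :: "real^'m^'m"
  sLam :: "real^'n^'n"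
  sW :: "real^'n^'n"    \<comment> \<open>covariance of process noise w_k\<close>
  sV :: "real^'p^'p"    \<comment> \<open>covariance of measurement noise v_k\<close>
  sP0 :: "real^'n^'n"   \<comment> \<open>covariance of the (zero-mean) initial state x_0\<close>

text \<open>Riccati recursion; Sback n is S_{T-n}.\<close>
primrec Sback :: "('n::finite,'m::finite,'p::finite) lqg \<Rightarrow> nat \<Rightarrow> real^'n^'n" where
  "Sback s 0 = sLam s"
| "Sback s (Suc n) = (let S = Sback s n; A = sA s; B = sB s in
      sQ s + transpose A ** (S - S ** B ** matrix_inv (sR s + transpose B ** S ** B)
                                  ** transpose B ** S) ** A)"

definition Sric :: "('n::finite,'m::finite,'p::finite) lqg \<Rightarrow> nat \<Rightarrow> nat \<Rightarrow> real^'n^'n" where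
  "Sric s T k = Sback s (T - k)"

definition Lgain :: "('n::finite,'m::finite,'p::finite) lqg \<Rightarrow> nat \<Rightarrow> nat \<Rightarrow> real^'n^'m" where
  "Lgain s T k = (let S = Sric s T (Suc k); B = sB s in
     matrix_inv (sR s + transpose B ** S ** B) ** transpose B ** S ** sA s)"

text \<open>Gamma_k for 0 <= k <= T-1; for k >= T no control is applied any more and Gamma_k = 0.\<close>
definition Gam :: "('n::finite,'m::finite,'p::finite) lqg \<Rightarrow> nat \<Rightarrow> nat \<Rightarrow> real^'n^'n" where
  "Gam s T k = (if k < T then
     (let S = Sric s T (Suc k); B = sB s in
        transpose (Lgain s T k) ** (sR s + transpose B ** S ** B) ** Lgain s T k)
   else 0)"

text \<open>Kalman filter: predicted covariance P_{k|k-1} and gain K_k.\<close>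
fun Ppred :: "('n::finite,'m::finite,'p::finite) lqg \<Rightarrow> nat \<Rightarrow> real^'n^'n"
and Kgain :: "('n::finite,'m::finite,'p::finite) lqg \<Rightarrow> nat \<Rightarrow> real^'p^'n" where
  "Ppred s 0 = sP0 s"
| "Ppred s (Suc k) = sA s ** (Ppred s k - Kgain s k ** sC s ** Ppred s k) ** transpose (sA s) + sW s"
| "Kgain s k = Ppred s k ** transpose (sC s)
      ** matrix_inv (sC s ** Ppred s k ** transpose (sC s) + sV s)"

text \<open>Closed loop under the certainty-equivalence controller u_k = -L_k xhat_{k|k}[L+1]
  and a scheduling rule sched k j est (the decision delta_k[j] of scheduler j at time k,
  given the estimates est j' = xhat_{k|k}[j'] of all nodes).
  State at time k: (x_k, \<lambda>j. xhat_{k|k}[j]) for j = 1..L+1 (node L+1 is the controller).\<close>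
fun cl :: "('n::finite,'m::finite,'p::finite) lqg \<Rightarrow> nat \<Rightarrow> nat
           \<Rightarrow> (nat \<Rightarrow> nat \<Rightarrow> (nat \<Rightarrow> real^'n) \<Rightarrow> bool)
           \<Rightarrow> ('a \<Rightarrow> real^'n) \<Rightarrow> (nat \<Rightarrow> 'a \<Rightarrow> real^'n) \<Rightarrow> (nat \<Rightarrow> 'a \<Rightarrow> real^'p)
           \<Rightarrow> nat \<Rightarrow> 'a \<Rightarrow> (real^'n) \<times> (nat \<Rightarrow> real^'n)" where
  "cl s T L sched x0 w v 0 \<omega> =
     (let y0 = sC s *v x0 \<omega> + v 0 \<omega>;
          xh1 = Kgain s 0 *v y0   \<comment> \<open>xhat_{0|-1}[1] = 0 = E x_0\<close>
      in (x0 \<omega>, \<lambda>j. if j = 1 then xh1 else 0))"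
| "cl s T L sched x0 w v (Suc k) \<omega> =
     (let (x, xh) = cl s T L sched x0 w v k \<omega>;
          A = sA s; B = sB s; C = sC s;
          u = - (Lgain s T k *v xh (L + 1));
          x' = A *v x + B *v u + w k \<omega>;
          y' = C *v x' + v (Suc k) \<omega>;
          pr = A *v xh 1 + B *v u;
          xh1' = pr + Kgain s (Suc k) *v (y' - C *v pr)
      in (x', \<lambda>j. if j = 1 then xh1'
                  else if sched k (j - 1) xh then A *v xh (j - 1) + B *v u
                  else A *v xh j + B *v u))"

definition cl_x where "cl_x s T L sched x0 w v k \<omega> = fst (cl s T L sched x0 w v k \<omega>)"
definition cl_xh where "cl_xh s T L sched x0 w v k \<omega> = snd (cl s T L sched x0 w v k \<omega>)"
definition cl_u where
  "cl_u s T L sched x0 w v k \<omega> = - (Lgain s T k *v cl_xh s T L sched x0 w v k \<omega> (L + 1))"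
definition cl_delta where
  "cl_delta s T L sched x0 w v k j \<omega> = sched k j (cl_xh s T L sched x0 w v k \<omega>)"

definition lagr_cost where
  "lagr_cost M s T L lam sched x0 w v =
     integral\<^sup>L M (\<lambda>\<omega>. cl_x s T L sched x0 w v T \<omega> \<bullet> (sLam s *v cl_x s T L sched x0 w v T \<omega>)
        + (\<Sum>k<T. cl_x s T L sched x0 w v k \<omega> \<bullet> (sQ s *v cl_x s T L sched x0 w v k \<omega>)
                 + cl_u s T L sched x0 w v k \<omega> \<bullet> (sR s *v cl_u s T L sched x0 w v k \<omega>)))
   + (\<Sum>j\<in>{1..L}. lam j * integral\<^sup>L M (\<lambda>\<omega>. \<Sum>k<T. of_bool (cl_delta s T L sched x0 w v k j \<omega>)))"

definition dVoI where
  "dVoI s T L lam k j est =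
     (let xt = est j - est (j + 1); P = mpow (sA s) (L + 1 - j) in
        lam j - xt \<bullet> ((transpose P ** Gam s T (k + (L + 1 - j)) ** P) *v xt))"

definition dvoi_sched where
  "dvoi_sched s T L lam k j est \<longleftrightarrow> k + (L + 1 - j) \<le> T \<and> dVoI s T L lam k j est < 0"

definition periodic_sched :: "nat \<Rightarrow> nat \<Rightarrow> (nat \<Rightarrow> real^'n) \<Rightarrow> bool" where
  "periodic_sched k j est = True"

datatype noise_idx = NX0 | NW nat | NV nat

definition noise_family where
  "noise_family M x0 w v i = (case i of
      NX0 \<Rightarrow> {x0 -` A \<inter> space M | A. A \<in> sets (borel :: (real^'n) measure)}
    | NW k \<Rightarrow> {w k -` A \<inter> space M | A. A \<in> sets (borel :: (real^'n) measure)}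
    | NV k \<Rightarrow> {v k -` A \<inter> space M | A. A \<in> sets (borel :: (real^'p) measure)})"

definition lqg_noise :: "'a measure \<Rightarrow> ('n::finite,'m::finite,'p::finite) lqg
   \<Rightarrow> ('a \<Rightarrow> real^'n) \<Rightarrow> (nat \<Rightarrow> 'a \<Rightarrow> real^'n) \<Rightarrow> (nat \<Rightarrow> 'a \<Rightarrow> real^'p) \<Rightarrow> bool" where
  "lqg_noise M s x0 w v \<longleftrightarrow> prob_space M
     \<and> gaussian_vec M x0 (sP0 s) \<and> (\<forall>k. gaussian_vec M (w k) (sW s)) \<and> (\<forall>k. gaussian_vec M (v k) (sV s))
     \<and> prob_space.indep_sets M (noise_family M x0 w v) UNIV"

definition lqg_wf :: "('n::finite,'m::finite,'p::finite) lqg \<Rightarrow> bool" where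
  "lqg_wf s \<longleftrightarrow> psd (sQ s) \<and> pd (sR s) \<and> psd (sLam s) \<and> psd (sW s) \<and> pd (sV s) \<and> psd (sP0 s)"

end

theory Submission
  imports Defs
begin

text \<open>
  Completing squares along the Riccati recursion turns the control cost into a constant plus
  \<open>\<Sum>k. E (e\<^sub>k \<bullet> \<Gamma>\<^sub>k e\<^sub>k)\<close>, where \<open>e\<^sub>k\<close> is the estimation error at the controller: the Kalman
  filtering error plus the mismatch errors of the schedulers. The filtering error is independent of
  the mismatch errors. Every decision depends on a mismatch error only through a quadratic form, and
  the innovations are independent and symmetric, so the joint law of the mismatch errors does not
  change when those of the first \<open>p\<close> schedulers are all negated. Hence all cross terms vanish in
  expectation, even when a transmission merges two mismatch errors.

  Compare with the cost-to-go under permanent transmission. If scheduler \<open>j\<close> withholds its mismatch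
  error \<open>z\<close> at time \<open>k\<close>, then \<open>z\<close> reaches the controller one step later, which adds exactly one
  term \<open>A\<^sup>m z \<bullet> \<Gamma>\<^sub>k\<^sub>+\<^sub>m (A\<^sup>m z)\<close> with \<open>m = L + 1 - j\<close>, and saves \<open>\<lambda> j\<close>. So up to a constant the
  Lagrangian of a policy is the expected sum over \<open>k\<close> and \<open>j\<close> of \<open>\<lambda> j\<close> if scheduler \<open>j\<close> transmits and
  of that term otherwise. The rule based on the value of information makes each summand at most
  \<open>\<lambda> j\<close>, its value under the periodic policy.
\<close>

section \<open>Uniqueness of characteristic functions\<close>

text \<open>Decisions are nonlinear in the mismatch errors, so uncorrelated filtering errors and
  innovations would not be enough: independence is required. Gaussianity is given only through
  one-dimensional projections, so independence is read off from a factorisation of characteristic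
  functions, and this calls for a uniqueness theorem in several dimensions.

  On the mismatch side the obstacle is that a coordinate may combine an error received from the
  previous scheduler with one that was withheld, so the sign of a single coordinate depends on two
  earlier decisions. Negating a whole prefix avoids this: only the decision at the edge of the
  prefix determines which prefix has to be negated one step earlier. Prefixes suffice, because each
  cross term between mismatch errors that occurs pairs a sum over a prefix with the next coordinate,
  or parts of two neighbouring coordinates.

  The two policies generate different error laws, so they are not compared path by path. The cost is
  first rewritten until each summand has a bound that depends on the multiplier only.\<close>

lemma weighted_char_distr:
  fixes W X :: "'a \<Rightarrow> real"
  assumes [measurable]: "W \<in> borel_measurable N" "X \<in> borel_measurable N"
    and W: "\<And>x. 0 \<le> W x" "integrable N W" and c: "(\<integral>x. W x \<partial>N) = c" "0 < c"
  defines "D \<equiv> distr (density N (\<lambda>x. ennreal (W x / c))) borel X"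
  shows "real_distribution D"
    and "char D t = (CLINT x|N. W x *\<^sub>R iexp (t * X x)) / of_real c"
    and "A \<in> sets borel \<Longrightarrow> measure D A = (\<integral>x. W x * indicator A (X x) \<partial>N) / c"
proof -
  have "(\<integral>\<^sup>+x. ennreal (W x / c) \<partial>N) = ennreal (\<integral>x. W x / c \<partial>N)"
    using W c by (intro nn_integral_eq_integral) auto
  also have "\<dots> = 1" using c by simp
  finally have "prob_space (density N (\<lambda>x. ennreal (W x / c)))"
    by (intro prob_spaceI) (simp add: emeasure_density cong: nn_integral_cong)
  then have "prob_space D"
    unfolding D_def by (rule prob_space.prob_space_distr) simp
  then interpret D: prob_space D .
  show rd: "real_distribution D"
    by unfold_locales (simp add: D_def)
  have "char D t = (CLINT x|N. (W x / c) *\<^sub>R iexp (t * X x))"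
    unfolding char_def D_def using W c
    by (subst integral_distr) (auto simp: integral_density simp del: scaleR_conv_of_real)
  also have "\<dots> = (CLINT x|N. (W x *\<^sub>R iexp (t * X x)) / of_real c)"
    by (simp add: scaleR_conv_of_real divide_inverse ac_simps)
  also have "\<dots> = (CLINT x|N. W x *\<^sub>R iexp (t * X x)) / of_real c"
    by simp
  finally show "char D t = \<dots>" .
  assume A[measurable]: "A \<in> sets borel"
  have "measure D A = (\<integral>x. indicator A x \<partial>D)"
    by (simp add: D_def)
  also have "\<dots> = (\<integral>x. (W x / c) *\<^sub>R indicator A (X x) \<partial>N)"
    unfolding D_def using W c
    by (subst integral_distr) (auto simp: integral_density simp del: integral_indicator)
  finally show "measure D A = (\<integral>x. W x * indicator A (X x) \<partial>N) / c"
    by simp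
qed

text \<open>At \<open>t = 0\<close> the hypothesis says that the weights have the same total mass
  \<open>c\<close>. Division by \<open>c\<close> gives two probability laws of \<open>X\<close> with
  equal characteristic functions, to which Levy's theorem on the line applies; if
  \<open>c = 0\<close>, the weights vanish almost everywhere.\<close>

lemma weighted_char_unique:
  fixes W X :: "'a \<Rightarrow> real"
  assumes [measurable_cong]: "sets \<nu> = sets \<mu>"
    and [measurable]: "W \<in> borel_measurable \<mu>" "X \<in> borel_measurable \<mu>"
    and W: "\<And>x. 0 \<le> W x" "integrable \<mu> W" "integrable \<nu> W"
    and eq: "\<And>t. (CLINT x|\<mu>. W x *\<^sub>R iexp (t * X x)) = (CLINT x|\<nu>. W x *\<^sub>R iexp (t * X x))"
    and A[measurable]: "A \<in> sets borel"
  shows "(\<integral>x. W x * indicator A (X x) \<partial>\<mu>) = (\<integral>x. W x * indicator A (X x) \<partial>\<nu>)"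
proof -
  define c where "c = (\<integral>x. W x \<partial>\<mu>)"
  have "complex_of_real (\<integral>x. W x \<partial>\<mu>) = complex_of_real (\<integral>x. W x \<partial>\<nu>)"
    using eq[of 0] by (simp add: scaleR_conv_of_real)
  then have c\<nu>: "(\<integral>x. W x \<partial>\<nu>) = c" by (simp add: c_def)
  have "0 \<le> c" unfolding c_def using W by simp
  then consider "c = 0" | "0 < c" by linarith
  then show ?thesis
  proof cases
    case 1
    have "AE x in \<mu>. W x = 0" "AE x in \<nu>. W x = 0"
      using 1 c\<nu> W integral_nonneg_eq_0_iff_AE[of \<mu> W] integral_nonneg_eq_0_iff_AE[of \<nu> W]
      by (auto simp: c_def)
    then have "(\<integral>x. W x * indicator A (X x) \<partial>\<mu>) = 0" "(\<integral>x. W x * indicator A (X x) \<partial>\<nu>) = 0"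
      by (auto intro!: integral_eq_zero_AE)
    then show ?thesis by simp
  next
    case 2
    have m\<nu>: "W \<in> borel_measurable \<nu>" "X \<in> borel_measurable \<nu>" by simp_all
    note wm = weighted_char_distr[of W \<mu> X c, OF _ _ W(1,2) c_def[symmetric] 2]
    note wn = weighted_char_distr[of W \<nu> X c, OF _ _ W(1,3) c\<nu> 2]
    have "distr (density \<mu> (\<lambda>x. ennreal (W x / c))) borel X
        = distr (density \<nu> (\<lambda>x. ennreal (W x / c))) borel X"
      by (intro Levy_uniqueness wm(1) wn(1) ext) (simp_all only: wm(2)[OF assms(2,3)] wn(2)[OF m\<nu>] eq assms(2,3) m\<nu>)
    then show ?thesis using wm(3)[OF _ _ A] wn(3)[OF _ _ A] 2 by simp
  qed
qed

text \<open>Levy's uniqueness theorem is applied to one coordinate after another, with the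
  characters of the other coordinates made nonnegative by the weights \<open>1 + cos\<close> and \<open>1 + sin\<close>.\<close>

theorem char_unique_euclidean:
  fixes \<mu> \<nu> :: "'a::euclidean_space measure"
  assumes "prob_space \<mu>" "prob_space \<nu>"
    and [measurable_cong]: "sets \<mu> = sets borel" "sets \<nu> = sets borel"
    and eq: "\<And>c. (CLINT x|\<mu>. iexp (c \<bullet> x)) = (CLINT x|\<nu>. iexp (c \<bullet> x))"
  shows "\<mu> = \<nu>"
proof -
  interpret \<mu>: prob_space \<mu> by fact
  interpret \<nu>: prob_space \<nu> by fact
  define I where "I D A x = (\<Prod>i\<in>D. indicator (A i) (x \<bullet> i) :: real)"
    for D and A :: "'a \<Rightarrow> real set" and x :: 'a
  have I01: "0 \<le> I D A x" "I D A x \<le> 1" for D A x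
    unfolding I_def by (auto intro!: prod_nonneg prod_le_1)
  have I_meas: "I D A \<in> borel_measurable borel" if "\<And>i. A i \<in> sets borel" for D A
    unfolding I_def[abs_def] using that by measurable
  \<comment> \<open>Coordinates in \<open>D\<close> are already restricted to Borel sets, while a
    character in an arbitrary direction \<open>c\<close> remains. Quantifying over all
    \<open>c\<close> allows the character along the next \<open>e\<close> to be traded for an
    indicator. In the end \<open>D = Basis\<close> and \<open>c = 0\<close> leave the measures of
    boxes.\<close>
  have key: "\<forall>A c. (\<forall>i. A i \<in> sets borel) \<longrightarrow>
      (CLINT x|\<mu>. I D A x *\<^sub>R iexp (c \<bullet> x)) = (CLINT x|\<nu>. I D A x *\<^sub>R iexp (c \<bullet> x))"
    if "finite D" for D :: "'a set"
    using that
  proof (induction D)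
    case empty
    then show ?case using eq by (simp add: I_def)
  next
    case (insert e D)
    show ?case
    proof (intro allI impI)
      fix A :: "'a \<Rightarrow> real set" and c :: 'a assume A: "\<forall>i. A i \<in> sets borel"
      have [measurable]: "I D A \<in> borel_measurable borel" "A e \<in> sets borel"
        using A I_meas by auto
      have IH: "(CLINT x|\<mu>. I D A x *\<^sub>R iexp (c \<bullet> x)) = (CLINT x|\<nu>. I D A x *\<^sub>R iexp (c \<bullet> x))" for c
        using insert.IH A by blast
      have int: "integrable N (\<lambda>x. I D A x *\<^sub>R iexp (c \<bullet> x))"
        if "prob_space N" and [measurable_cong]: "sets N = sets borel" for N c
      proof -
        interpret prob_space N by fact
        show ?thesis
          by (rule integrable_const_bound[where B=1]) (use I01 in auto)
      qed
      have Ifin: "integrable N (\<lambda>x. I D A x * g x)"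
        if "prob_space N" and [measurable_cong]: "sets N = sets borel"
          and [measurable]: "g \<in> borel_measurable borel" and g: "\<And>x. \<bar>g x\<bar> \<le> 2" for N g
      proof -
        interpret prob_space N by fact
        have "\<bar>I D A x * g x\<bar> \<le> 2" for x
          using mult_mono[of "I D A x" 1 "\<bar>g x\<bar>" 2] I01[of D A x] g[of x] by (simp add: abs_mult)
        then show ?thesis
          by (intro integrable_const_bound[where B=2]) auto
      qed
      \<comment> \<open>\<open>1 + f\<close> is real and nonnegative, as a weight must be. By the
        shape of \<open>f\<close>, its product with a character along \<open>e\<close> combines the
        characters in directions \<open>t e\<close>, \<open>c + t e\<close> and
        \<open>- c + t e\<close>, all covered by the induction hypothesis.\<close>
      have trig: "(\<integral>x. (I D A x * (1 + f (c \<bullet> x))) * indicator (A e) (x \<bullet> e) \<partial>\<mu>)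
          = (\<integral>x. (I D A x * (1 + f (c \<bullet> x))) * indicator (A e) (x \<bullet> e) \<partial>\<nu>)"
        if f: "\<And>y. complex_of_real (f y) = a * iexp y + b * iexp (- y)"
          and f1: "\<And>y. \<bar>f y\<bar> \<le> 1" and [measurable]: "f \<in> borel_measurable borel" for f a b c
      proof (rule weighted_char_unique)
        have b: "0 \<le> 1 + f y" "\<bar>1 + f y\<bar> \<le> 2" for y using f1[of y] by auto
        show "0 \<le> I D A x * (1 + f (c \<bullet> x))" for x
          using I01 b by simp
        show "integrable \<mu> (\<lambda>x. I D A x * (1 + f (c \<bullet> x)))"
          "integrable \<nu> (\<lambda>x. I D A x * (1 + f (c \<bullet> x)))"
          using assms b by (auto intro!: Ifin)
        fix t
        have *: "(CLINT x|N. (I D A x * (1 + f (c \<bullet> x))) *\<^sub>R iexp (t * (x \<bullet> e)))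
          = (CLINT x|N. I D A x *\<^sub>R iexp ((t *\<^sub>R e) \<bullet> x))
             + a * (CLINT x|N. I D A x *\<^sub>R iexp ((c + t *\<^sub>R e) \<bullet> x))
             + b * (CLINT x|N. I D A x *\<^sub>R iexp ((- c + t *\<^sub>R e) \<bullet> x))"
          if N: "prob_space N" "sets N = sets borel" for N
        proof -
          have "(I D A x * (1 + f (c \<bullet> x))) *\<^sub>R iexp (t * (x \<bullet> e))
            = I D A x *\<^sub>R iexp ((t *\<^sub>R e) \<bullet> x) + a * (I D A x *\<^sub>R iexp ((c + t *\<^sub>R e) \<bullet> x))
              + b * (I D A x *\<^sub>R iexp ((- c + t *\<^sub>R e) \<bullet> x))" for x
            unfolding scaleR_conv_of_real of_real_mult of_real_add f
            by (simp add: inner_add_left inner_diff_left inner_commute[of x e] distrib_left distrib_right exp_add exp_diff exp_minus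
                field_simps)
          then show ?thesis
            using int[OF N] by (simp only: Bochner_Integration.integral_add integrable_mult_right
                Bochner_Integration.integrable_add integral_mult_right_zero)
        qed
        show "(CLINT x|\<mu>. (I D A x * (1 + f (c \<bullet> x))) *\<^sub>R iexp (t * (x \<bullet> e)))
          = (CLINT x|\<nu>. (I D A x * (1 + f (c \<bullet> x))) *\<^sub>R iexp (t * (x \<bullet> e)))"
          using assms by (simp only: * IH)
      qed (auto simp: assms)
      have cosE: "complex_of_real (cos y) = (1/2) * iexp y + (1/2) * iexp (- y)"
        and sinE: "complex_of_real (sin y) = (-\<i>/2) * iexp y + (\<i>/2) * iexp (- y)" for y
        by (auto simp: complex_eq_iff exp_eq_polar cis.code)
      have II: "I (insert e D) A x = I D A x * indicator (A e) (x \<bullet> e)" for x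
        using insert.hyps by (simp add: I_def mult.commute)
      \<comment> \<open>In direction \<open>0\<close> the weight \<open>1 + cos\<close> is the
        constant \<open>2\<close>. This gives the part without a character, which is later
        subtracted to isolate the cosine and sine integrals.\<close>
      have one: "(\<integral>x. I (insert e D) A x \<partial>\<mu>) = (\<integral>x. I (insert e D) A x \<partial>\<nu>)"
      proof -
        have h: "I D A x * (1 + cos (0 \<bullet> x)) * indicator (A e) (x \<bullet> e) = 2 * I (insert e D) A x" for x
          by (simp add: II)
        show ?thesis using trig[OF cosE, of 0] unfolding h by simp
      qed
      have split: "(\<integral>x. (I D A x * (1 + f (c \<bullet> x))) * indicator (A e) (x \<bullet> e) \<partial>N)
           = (\<integral>x. I (insert e D) A x \<partial>N) + (\<integral>x. I (insert e D) A x * f (c \<bullet> x) \<partial>N)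
        \<and> integrable N (\<lambda>x. I (insert e D) A x * f (c \<bullet> x))"
        if N: "prob_space N" "sets N = sets borel" and f1: "\<And>y. \<bar>f y\<bar> \<le> 1"
          and [measurable]: "f \<in> borel_measurable borel" for f N
      proof -
        have "\<bar>indicator (A e) (x \<bullet> e) * f (c \<bullet> x)\<bar> \<le> 2" for x
          using f1[of "c \<bullet> x"] by (auto split: split_indicator)
        then have i: "integrable N (\<lambda>x. I D A x * (indicator (A e) (x \<bullet> e) * f (c \<bullet> x)))"
          "integrable N (\<lambda>x. I D A x * indicator (A e) (x \<bullet> e))"
          by (auto intro!: Ifin N split: split_indicator)
        have e: "(I D A x * (1 + f (c \<bullet> x))) * indicator (A e) (x \<bullet> e)
          = I D A x * indicator (A e) (x \<bullet> e) + I D A x * (indicator (A e) (x \<bullet> e) * f (c \<bullet> x))" for x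
          by (simp add: field_simps)
        show ?thesis unfolding II e using i by (simp add: mult.assoc)
      qed
      have sp: "(CLINT x|N. I (insert e D) A x *\<^sub>R iexp (c \<bullet> x))
         = of_real (\<integral>x. I (insert e D) A x * cos (c \<bullet> x) \<partial>N)
           + \<i> * of_real (\<integral>x. I (insert e D) A x * sin (c \<bullet> x) \<partial>N)"
        if N: "prob_space N" "sets N = sets borel" for N
      proof -
        have "I (insert e D) A x *\<^sub>R iexp (c \<bullet> x) = of_real (I (insert e D) A x * cos (c \<bullet> x))
            + \<i> * of_real (I (insert e D) A x * sin (c \<bullet> x))" for x
          by (simp add: complex_eq_iff exp_eq_polar cis.code)
        moreover have "integrable N (\<lambda>x. I (insert e D) A x * cos (c \<bullet> x))"
          "integrable N (\<lambda>x. I (insert e D) A x * sin (c \<bullet> x))"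
          using split[OF N, of cos] split[OF N, of sin] by auto
        ultimately show ?thesis
          by (simp only:) (subst Bochner_Integration.integral_add, auto simp del: of_real_mult)
      qed
      have "(\<integral>x. I (insert e D) A x * cos (c \<bullet> x) \<partial>\<mu>) = (\<integral>x. I (insert e D) A x * cos (c \<bullet> x) \<partial>\<nu>)"
        using trig[OF cosE, of c] split[of \<mu> cos] split[of \<nu> cos] one assms by simp
      moreover have "(\<integral>x. I (insert e D) A x * sin (c \<bullet> x) \<partial>\<mu>) = (\<integral>x. I (insert e D) A x * sin (c \<bullet> x) \<partial>\<nu>)"
        using trig[OF sinE, of c] split[of \<mu> sin] split[of \<nu> sin] one assms by simp
      ultimately show "(CLINT x|\<mu>. I (insert e D) A x *\<^sub>R iexp (c \<bullet> x))
        = (CLINT x|\<nu>. I (insert e D) A x *\<^sub>R iexp (c \<bullet> x))"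
        using assms by (simp only: sp)
    qed
  qed
  have box: "emeasure \<mu> (box a b) = emeasure \<nu> (box a b)" for a b
  proof -
    have b: "I Basis (\<lambda>i. {a \<bullet> i <..< b \<bullet> i}) x = indicator (box a b) x" for x
      by (auto simp: I_def box_def indicator_def prod.If_cases[OF finite_Basis] split: if_splits)
    have "(CLINT x|\<mu>. I Basis (\<lambda>i. {a \<bullet> i <..< b \<bullet> i}) x *\<^sub>R iexp (0 \<bullet> x))
       = (CLINT x|\<nu>. I Basis (\<lambda>i. {a \<bullet> i <..< b \<bullet> i}) x *\<^sub>R iexp (0 \<bullet> x))"
      by (rule key[rule_format]) auto
    then have "complex_of_real (\<integral>x. indicator (box a b) x \<partial>\<mu>) = complex_of_real (\<integral>x. indicator (box a b) x \<partial>\<nu>)"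
      unfolding b by (simp add: scaleR_conv_of_real del: integral_indicator)
    then have "measure \<mu> (box a b) = measure \<nu> (box a b)"
      using assms(3,4) by (simp add: sets_eq_imp_space_eq[OF assms(3)] sets_eq_imp_space_eq[OF assms(4)])
    then show ?thesis by (simp add: \<mu>.emeasure_eq_measure \<nu>.emeasure_eq_measure)
  qed
  let ?E = "range (\<lambda>(a, b). box a b :: 'a set)"
  show ?thesis
  proof (rule measure_eqI_generator_eq[where E="?E" and \<Omega>=UNIV and A="\<lambda>n::nat. box (- (real n *\<^sub>R One)) (real n *\<^sub>R One)"])
    show "Int_stable ?E"
      by (auto simp: Int_stable_def box_Int_box)
    show "sets \<mu> = sigma_sets UNIV ?E" "sets \<nu> = sigma_sets UNIV ?E"
      by (simp_all add: assms borel_eq_box)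
    show "(\<Union>n::nat. box (- (real n *\<^sub>R One)) (real n *\<^sub>R One)) = (UNIV :: 'a set)"
      using UN_box_eq_UNIV by simp
  qed (auto simp: box)
qed

section \<open>Gaussian vectors and independence\<close>

text \<open>Prescribing the characteristic function treats degenerate directions, where there is no
  density, like all others, and is directly stable under linear maps and independent sums.\<close>

definition char_gauss :: "'a measure \<Rightarrow> ('a \<Rightarrow> real^'n) \<Rightarrow> real^'n^'n \<Rightarrow> bool" where
  "char_gauss M X P \<longleftrightarrow> X \<in> borel_measurable M \<and> transpose P = P \<and>
     (\<forall>a. (CLINT \<omega>|M. iexp (a \<bullet> X \<omega>)) = of_real (exp (- (a \<bullet> (P *v a)) / 2)))"

definition square_integrable :: "'a measure \<Rightarrow> ('a \<Rightarrow> 'b::euclidean_space) \<Rightarrow> bool" where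
  "square_integrable M X \<longleftrightarrow> X \<in> borel_measurable M \<and> integrable M (\<lambda>\<omega>. (norm (X \<omega>))\<^sup>2)"

lemma borel_measurable_matrix_vector_mult [measurable (raw)]:
  fixes A :: "real^'n^'m"
  assumes "X \<in> borel_measurable N"
  shows "(\<lambda>\<omega>. A *v X \<omega>) \<in> borel_measurable N"
proof -
  have "(\<lambda>x. A *v x) \<in> borel_measurable borel"
    by (intro borel_measurable_continuous_onI linear_continuous_on linear_conv_bounded_linear[THEN iffD1]) simp
  from measurable_compose[OF assms this] show ?thesis .
qed

lemma (in prob_space) gaussian_vec_char_gauss:
  assumes g: "gaussian_vec M X P" and P: "psd P"
  shows "char_gauss M X P"
  unfolding char_gauss_def
proof (intro conjI allI)
  show X[measurable]: "X \<in> borel_measurable M" using g by (simp add: gaussian_vec_def)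
  show "transpose P = P" using P by (simp add: psd_def)
  fix a
  let ?q = "a \<bullet> (P *v a)"
  show "(CLINT \<omega>|M. iexp (a \<bullet> X \<omega>)) = of_real (exp (- ?q / 2))"
  proof (cases "?q = 0")
    case True
    then have "AE \<omega> in M. a \<bullet> X \<omega> = 0" using g by (auto simp: gaussian_vec_def split: if_splits)
    then have "(CLINT \<omega>|M. iexp (a \<bullet> X \<omega>)) = (CLINT \<omega>|M. 1)"
      by (intro integral_cong_AE) auto
    then show ?thesis using True by (simp add: prob_space)
  next
    case False
    then have "0 < ?q" using P by (metis psd_def order_le_less)
    define \<sigma> where "\<sigma> = sqrt ?q"
    have \<sigma>: "0 < \<sigma>" "\<sigma>\<^sup>2 = ?q" using \<open>0 < ?q\<close> by (auto simp: \<sigma>_def)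
    have "distributed M lborel (\<lambda>\<omega>. a \<bullet> X \<omega>) (normal_density 0 \<sigma>)"
      using g False by (auto simp: gaussian_vec_def \<sigma>_def split: if_splits)
    then have "distributed M lborel (\<lambda>\<omega>. (a \<bullet> X \<omega>) / \<sigma>) std_normal_density"
      using normal_standard_normal_convert[OF \<sigma>(1), of _ 0] by simp
    then have d: "distr M lborel (\<lambda>\<omega>. (a \<bullet> X \<omega>) / \<sigma>) = std_normal_distribution"
      by (simp add: distributed_def)
    have "char std_normal_distribution \<sigma> = (CLINT \<omega>|M. iexp (\<sigma> * ((a \<bullet> X \<omega>) / \<sigma>)))"
      unfolding d[symmetric] char_def by (subst integral_distr) auto
    also have "\<dots> = (CLINT \<omega>|M. iexp (a \<bullet> X \<omega>))"
      using \<sigma> by simp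
    finally show ?thesis
      by (simp add: char_std_normal_distribution \<sigma>)
  qed
qed

lemma (in prob_space) gaussian_vec_square_integrable:
  assumes g: "gaussian_vec M X P" and P: "psd P"
  shows "square_integrable M X"
  unfolding square_integrable_def
proof
  show X[measurable]: "X \<in> borel_measurable M" using g by (simp add: gaussian_vec_def)
  have "integrable M (\<lambda>\<omega>. (a \<bullet> X \<omega>)\<^sup>2)" for a
  proof (cases "a \<bullet> (P *v a) = 0")
    case True
    then have "AE \<omega> in M. a \<bullet> X \<omega> = 0" using g by (auto simp: gaussian_vec_def split: if_splits)
    then have "integrable M (\<lambda>\<omega>. (a \<bullet> X \<omega>)\<^sup>2) = integrable M (\<lambda>\<omega>. 0 :: real)"
      by (intro integrable_cong_AE) auto
    then show ?thesis by simp
  next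
    case False
    define \<sigma> where "\<sigma> = sqrt (a \<bullet> (P *v a))"
    have "0 \<le> a \<bullet> (P *v a)" using P by (simp add: psd_def)
    then have \<sigma>: "0 < \<sigma>" using False by (simp add: \<sigma>_def)
    have "distributed M lborel (\<lambda>\<omega>. a \<bullet> X \<omega>) (normal_density 0 \<sigma>)"
      using g False by (auto simp: gaussian_vec_def \<sigma>_def split: if_splits)
    from distributed_integrable[OF this, of "\<lambda>x. x\<^sup>2"] integrable_normal_moment[OF \<sigma>, of 0 2]
    show ?thesis by simp
  qed
  then have "integrable M (\<lambda>\<omega>. \<Sum>b\<in>Basis. (b \<bullet> X \<omega>)\<^sup>2)" by (rule Bochner_Integration.integrable_sum)
  then show "integrable M (\<lambda>\<omega>. (norm (X \<omega>))\<^sup>2)"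
    by (simp add: power2_norm_eq_inner euclidean_inner[of "X _" "X _"] power2_eq_square[symmetric] inner_commute)
qed

lemma iexp_add: "iexp (x + y) = iexp x * iexp y"
  by (simp add: distrib_left exp_add)

lemma (in prob_space) integrable_iexp_real:
  "f \<in> borel_measurable M \<Longrightarrow> integrable M (\<lambda>\<omega>. iexp (f \<omega>))"
  by (rule integrable_const_bound[where B=1]) auto

lemma (in prob_space) char_unique_distr:
  fixes X Y :: "'a \<Rightarrow> 'b::euclidean_space"
  assumes [measurable]: "X \<in> borel_measurable M" "Y \<in> borel_measurable M"
    and eq: "\<And>a. (CLINT \<omega>|M. iexp (a \<bullet> X \<omega>)) = (CLINT \<omega>|M. iexp (a \<bullet> Y \<omega>))"
  shows "distr M borel X = distr M borel Y"
  by (rule char_unique_euclidean) (auto intro!: prob_space_distr simp: integral_distr eq)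

text \<open>The characteristic function depends on \<open>a\<close> through a quadratic form, hence
  is even.\<close>

lemma (in prob_space) char_gauss_uminus:
  assumes "char_gauss M X P"
  shows "distr M borel X = distr M borel (\<lambda>\<omega>. - X \<omega>)"
proof (rule char_unique_distr)
  show [measurable]: "X \<in> borel_measurable M" using assms by (simp add: char_gauss_def)
  show "(\<lambda>\<omega>. - X \<omega>) \<in> borel_measurable M" by simp
  fix a
  have "(CLINT \<omega>|M. iexp (a \<bullet> X \<omega>)) = (CLINT \<omega>|M. iexp ((- a) \<bullet> X \<omega>))"
  proof -
    have "(- a) \<bullet> (P *v (- a)) = a \<bullet> (P *v a)"
      using matrix_vector_mult_scaleR[of P "-1" a] by simp
    then show ?thesis using assms unfolding char_gauss_def by metis
  qed
  then show "(CLINT \<omega>|M. iexp (a \<bullet> X \<omega>)) = (CLINT \<omega>|M. iexp (a \<bullet> - X \<omega>))" by simp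
qed

text \<open>One component is often the sequence of all mismatch errors, which is not a Euclidean
  space; hence the topological classes. Second countability makes the Borel sets of the pair those
  of the product.\<close>

definition indep_pair :: "'a measure \<Rightarrow> ('a \<Rightarrow> 'b::second_countable_topology) \<Rightarrow>
    ('a \<Rightarrow> 'c::second_countable_topology) \<Rightarrow> bool" where
  "indep_pair M X Y \<longleftrightarrow> X \<in> borel_measurable M \<and> Y \<in> borel_measurable M \<and>
     distr M borel X \<Otimes>\<^sub>M distr M borel Y = distr M borel (\<lambda>\<omega>. (X \<omega>, Y \<omega>))"

lemma indep_pair_measurable:
  assumes "indep_pair M X Y"
  shows "X \<in> borel_measurable M" "Y \<in> borel_measurable M"
  using assms by (auto simp: indep_pair_def)

text \<open>The product law and the joint law have the same characteristic function on the product
  space.\<close>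

lemma (in prob_space) char_factor_imp_indep_pair:
  fixes X :: "'a \<Rightarrow> 'b::euclidean_space" and Y :: "'a \<Rightarrow> 'c::euclidean_space"
  assumes [measurable]: "X \<in> borel_measurable M" "Y \<in> borel_measurable M"
    and eq: "\<And>a b. (CLINT \<omega>|M. iexp (a \<bullet> X \<omega> + b \<bullet> Y \<omega>))
        = (CLINT \<omega>|M. iexp (a \<bullet> X \<omega>)) * (CLINT \<omega>|M. iexp (b \<bullet> Y \<omega>))"
  shows "indep_pair M X Y"
  unfolding indep_pair_def
proof (intro conjI assms)
  interpret X: prob_space "distr M borel X" by (rule prob_space_distr) simp
  interpret Y: prob_space "distr M borel Y" by (rule prob_space_distr) simp
  interpret XY: pair_prob_space "distr M borel X" "distr M borel Y" ..
  show "distr M borel X \<Otimes>\<^sub>M distr M borel Y = distr M borel (\<lambda>\<omega>. (X \<omega>, Y \<omega>))"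
  proof (rule char_unique_euclidean)
    show "prob_space (distr M borel X \<Otimes>\<^sub>M distr M borel Y)" by unfold_locales
    show "prob_space (distr M borel (\<lambda>\<omega>. (X \<omega>, Y \<omega>)))" by (rule prob_space_distr) simp
    have s[measurable_cong]: "sets (distr M borel X \<Otimes>\<^sub>M distr M borel Y) = sets (borel \<Otimes>\<^sub>M borel)"
      by (intro sets_pair_measure_cong) auto
    then show "sets (distr M borel X \<Otimes>\<^sub>M distr M borel Y) = sets borel"
      by (simp only: s borel_prod)
    fix c :: "'b \<times> 'c" obtain a b where c: "c = (a, b)" by (cases c)
    have m: "(\<lambda>x::'b\<times>'c. iexp (c \<bullet> x)) \<in> borel_measurable borel" by simp
    have m2: "(\<lambda>x::'b\<times>'c. iexp (c \<bullet> x)) \<in> borel_measurable (distr M borel X \<Otimes>\<^sub>M distr M borel Y)"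
      using m by (simp only: measurable_cong_sets[OF s refl] borel_prod)
    have i: "integrable (distr M borel X \<Otimes>\<^sub>M distr M borel Y) (\<lambda>x. iexp (c \<bullet> x))"
      by (rule XY.P.integrable_const_bound[where B=1]) (use m2 in auto)
    have "(CLINT x|distr M borel X \<Otimes>\<^sub>M distr M borel Y. iexp (c \<bullet> x))
       = (CLINT x|distr M borel X. (CLINT y|distr M borel Y. iexp (c \<bullet> (x, y))))"
      by (rule XY.integral_fst'[OF i, symmetric])
    also have "\<dots> = (CLINT x|distr M borel X. iexp (a \<bullet> x) * (CLINT y|distr M borel Y. iexp (b \<bullet> y)))"
      by (simp only: c inner_Pair iexp_add integral_mult_right_zero)
    also have "\<dots> = (CLINT x|distr M borel X. iexp (a \<bullet> x)) * (CLINT y|distr M borel Y. iexp (b \<bullet> y))"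
      by (simp only: integral_mult_left_zero)
    also have "\<dots> = (CLINT \<omega>|M. iexp (a \<bullet> X \<omega>)) * (CLINT \<omega>|M. iexp (b \<bullet> Y \<omega>))"
      by (simp add: integral_distr)
    also have "\<dots> = (CLINT x|distr M borel (\<lambda>\<omega>. (X \<omega>, Y \<omega>)). iexp (c \<bullet> x))"
      unfolding eq[symmetric] by (simp add: integral_distr c)
    finally show "(CLINT x|distr M borel X \<Otimes>\<^sub>M distr M borel Y. iexp (c \<bullet> x))
      = (CLINT x|distr M borel (\<lambda>\<omega>. (X \<omega>, Y \<omega>)). iexp (c \<bullet> x))" .
  qed simp
qed

text \<open>Fubini form: in any nonnegative integral \<open>Y\<close> may be replaced by an
  independent copy. Joining and regrouping variables then amounts to inserting and removing such
  copies.\<close>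

lemma (in prob_space) indep_pair_iff_nn_integral:
  fixes X :: "'a \<Rightarrow> 'b::second_countable_topology" and Y :: "'a \<Rightarrow> 'c::second_countable_topology"
  shows "indep_pair M X Y \<longleftrightarrow> X \<in> borel_measurable M \<and> Y \<in> borel_measurable M \<and>
    (\<forall>f \<in> borel_measurable borel. (\<integral>\<^sup>+\<omega>. f (X \<omega>, Y \<omega>) \<partial>M) = (\<integral>\<^sup>+\<omega>. \<integral>\<^sup>+\<omega>'. f (X \<omega>, Y \<omega>') \<partial>M \<partial>M))"
    (is "?L \<longleftrightarrow> _ \<and> _ \<and> ?R")
proof -
  { assume [measurable]: "X \<in> borel_measurable M" "Y \<in> borel_measurable M"
    interpret X: prob_space "distr M borel X" by (rule prob_space_distr) simp
    interpret Y: prob_space "distr M borel Y" by (rule prob_space_distr) simp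
    interpret XY: pair_prob_space "distr M borel X" "distr M borel Y" ..
    let ?P = "distr M borel X \<Otimes>\<^sub>M distr M borel Y" and ?J = "distr M borel (\<lambda>\<omega>. (X \<omega>, Y \<omega>))"
    have s[measurable_cong]: "sets ?P = sets borel"
      by (subst borel_prod[symmetric], intro sets_pair_measure_cong) auto
    have m: "(\<lambda>\<omega>. (X \<omega>, Y \<omega>)) \<in> measurable M borel"
      unfolding borel_prod[symmetric] by simp
    have P: "(\<integral>\<^sup>+x. f x \<partial>?P) = (\<integral>\<^sup>+\<omega>. \<integral>\<^sup>+\<omega>'. f (X \<omega>, Y \<omega>') \<partial>M \<partial>M)"
      if f: "f \<in> borel_measurable borel" for f
    proof -
      have f2[measurable]: "f \<in> borel_measurable (borel \<Otimes>\<^sub>M borel)" using f by (simp add: borel_prod)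
      have f3: "f \<in> borel_measurable ?P" using f by simp
      have "(\<integral>\<^sup>+x. f x \<partial>?P) = (\<integral>\<^sup>+x. \<integral>\<^sup>+y. f (x, y) \<partial>distr M borel Y \<partial>distr M borel X)"
        by (rule Y.nn_integral_fst[OF f3, symmetric])
      also have "\<dots> = (\<integral>\<^sup>+\<omega>. \<integral>\<^sup>+y. f (X \<omega>, y) \<partial>distr M borel Y \<partial>M)"
        by (subst nn_integral_distr) auto
      also have "\<dots> = (\<integral>\<^sup>+\<omega>. \<integral>\<^sup>+\<omega>'. f (X \<omega>, Y \<omega>') \<partial>M \<partial>M)"
        by (subst nn_integral_distr) auto
      finally show ?thesis .
    qed
    have J: "(\<integral>\<^sup>+x. f x \<partial>?J) = (\<integral>\<^sup>+\<omega>. f (X \<omega>, Y \<omega>) \<partial>M)"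
      if f: "f \<in> borel_measurable borel" for f
      by (subst nn_integral_distr[OF m]) (use f in auto)
    have "?P = ?J \<longleftrightarrow> ?R"
    proof
      assume "?P = ?J" then show ?R by (intro ballI) (simp only: P[symmetric] J[symmetric])
    next
      assume R: ?R
      show "?P = ?J"
      proof (rule measure_eqI)
        fix A assume "A \<in> sets ?P"
        then have A: "A \<in> sets borel" using s by simp
        then have i: "(indicator A :: _ \<Rightarrow> ennreal) \<in> borel_measurable borel" by simp
        have "(\<integral>\<^sup>+x. indicator A x \<partial>?P) = (\<integral>\<^sup>+x. indicator A x \<partial>?J)"
          using R P[OF i] J[OF i] i by simp
        then show "emeasure ?P A = emeasure ?J A" using A s by simp
      qed (simp only: s sets_distr)
    qed }
  then show ?thesis
    unfolding indep_pair_def by blast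
qed

lemma (in prob_space) indep_pair_nn_integral:
  assumes "indep_pair M X Y" "f \<in> borel_measurable borel"
  shows "(\<integral>\<^sup>+\<omega>. f (X \<omega>, Y \<omega>) \<partial>M) = (\<integral>\<^sup>+\<omega>. \<integral>\<^sup>+\<omega>'. f (X \<omega>, Y \<omega>') \<partial>M \<partial>M)"
  using assms by (simp add: indep_pair_iff_nn_integral)

lemma (in prob_space) indep_pair_compose:
  fixes X :: "'a \<Rightarrow> 'b::second_countable_topology" and Y :: "'a \<Rightarrow> 'c::second_countable_topology"
    and f :: "'b \<Rightarrow> 'd::second_countable_topology" and g :: "'c \<Rightarrow> 'e::second_countable_topology"
  assumes "indep_pair M X Y" and [measurable]: "f \<in> borel_measurable borel" "g \<in> borel_measurable borel"
  shows "indep_pair M (\<lambda>\<omega>. f (X \<omega>)) (\<lambda>\<omega>. g (Y \<omega>))"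
proof -
  have [measurable]: "X \<in> borel_measurable M" "Y \<in> borel_measurable M"
    using assms by (auto dest: indep_pair_measurable)
  have m: "(\<lambda>x. (f (fst x), g (snd x))) \<in> borel_measurable borel"
    unfolding borel_prod[symmetric] by measurable
  show ?thesis
    unfolding indep_pair_iff_nn_integral
  proof (intro conjI ballI)
    fix h :: "'d \<times> 'e \<Rightarrow> ennreal" assume "h \<in> borel_measurable borel"
    from measurable_compose[OF m this]
    show "(\<integral>\<^sup>+\<omega>. h (f (X \<omega>), g (Y \<omega>)) \<partial>M) = (\<integral>\<^sup>+\<omega>. \<integral>\<^sup>+\<omega>'. h (f (X \<omega>), g (Y \<omega>')) \<partial>M \<partial>M)"
      using indep_pair_nn_integral[OF assms(1)] by force
  qed auto
qed

lemma (in prob_space) indep_pair_char_mult: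
  fixes X :: "'a \<Rightarrow> 'b::euclidean_space" and Y :: "'a \<Rightarrow> 'c::euclidean_space"
  assumes i: "indep_pair M X Y"
  shows "(CLINT \<omega>|M. iexp (a \<bullet> X \<omega> + b \<bullet> Y \<omega>)) = (CLINT \<omega>|M. iexp (a \<bullet> X \<omega>)) * (CLINT \<omega>|M. iexp (b \<bullet> Y \<omega>))"
proof -
  have [measurable]: "X \<in> borel_measurable M" "Y \<in> borel_measurable M"
    using i by (auto dest: indep_pair_measurable)
  have "indep_pair M (\<lambda>\<omega>. iexp (a \<bullet> X \<omega>)) (\<lambda>\<omega>. iexp (b \<bullet> Y \<omega>))"
    by (rule indep_pair_compose[OF i]) auto
  then have "indep_var borel (\<lambda>\<omega>. iexp (a \<bullet> X \<omega>)) borel (\<lambda>\<omega>. iexp (b \<bullet> Y \<omega>))"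
    by (simp add: indep_pair_def indep_var_distribution_eq borel_prod)
  from indep_var_lebesgue_integral[OF this] show ?thesis
    unfolding iexp_add by (simp add: integrable_iexp_real)
qed

text \<open>Used to attach a fresh noise \<open>Y\<close> to \<open>X\<close>: the pair of
  \<open>X\<close> and \<open>Z\<close> is replaced by an independent copy, this copy is split, and
  \<open>X\<close> is reunited with \<open>Y\<close>.\<close>

lemma (in prob_space) indep_pair_join:
  fixes X :: "'a \<Rightarrow> 'b::second_countable_topology" and Y :: "'a \<Rightarrow> 'c::second_countable_topology"
    and Z :: "'a \<Rightarrow> 'd::second_countable_topology"
  assumes XZ: "indep_pair M X Z" and YXZ: "indep_pair M Y (\<lambda>\<omega>. (X \<omega>, Z \<omega>))"
  shows "indep_pair M (\<lambda>\<omega>. (X \<omega>, Y \<omega>)) Z"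
proof -
  have [measurable]: "X \<in> borel_measurable M" "Y \<in> borel_measurable M" "Z \<in> borel_measurable M"
    using XZ YXZ by (auto dest: indep_pair_measurable)
  have YX: "indep_pair M Y X"
    using indep_pair_compose[OF YXZ, of "\<lambda>y. y" fst] by (simp add: borel_prod[symmetric])
  show ?thesis
    unfolding indep_pair_iff_nn_integral
  proof (intro conjI ballI)
    show "(\<lambda>\<omega>. (X \<omega>, Y \<omega>)) \<in> borel_measurable M" unfolding borel_prod[symmetric] by simp
    fix f :: "('b \<times> 'c) \<times> 'd \<Rightarrow> ennreal" assume "f \<in> borel_measurable borel"
    then have [measurable]: "f \<in> borel_measurable ((borel \<Otimes>\<^sub>M borel) \<Otimes>\<^sub>M borel)" by (simp add: borel_prod)
    have "(\<lambda>p. f ((fst (snd p), fst p), snd (snd p))) \<in> borel_measurable (borel \<Otimes>\<^sub>M (borel \<Otimes>\<^sub>M borel))"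
      by measurable
    from indep_pair_nn_integral[OF YXZ this[unfolded borel_prod]]
    have "(\<integral>\<^sup>+\<omega>. f ((X \<omega>, Y \<omega>), Z \<omega>) \<partial>M) = (\<integral>\<^sup>+\<omega>. \<integral>\<^sup>+\<omega>'. f ((X \<omega>', Y \<omega>), Z \<omega>') \<partial>M \<partial>M)" by simp
    also have "\<dots> = (\<integral>\<^sup>+\<omega>. \<integral>\<^sup>+\<omega>'. \<integral>\<^sup>+\<omega>''. f ((X \<omega>', Y \<omega>), Z \<omega>'') \<partial>M \<partial>M \<partial>M)"
    proof (rule nn_integral_cong)
      fix \<omega>
      have "(\<lambda>p. f ((fst p, Y \<omega>), snd p)) \<in> borel_measurable (borel \<Otimes>\<^sub>M borel)" by measurable
      from indep_pair_nn_integral[OF XZ this[unfolded borel_prod]]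
      show "(\<integral>\<^sup>+\<omega>'. f ((X \<omega>', Y \<omega>), Z \<omega>') \<partial>M) = (\<integral>\<^sup>+\<omega>'. \<integral>\<^sup>+\<omega>''. f ((X \<omega>', Y \<omega>), Z \<omega>'') \<partial>M \<partial>M)"
        by simp
    qed
    also have "\<dots> = (\<integral>\<^sup>+\<omega>. \<integral>\<^sup>+\<omega>''. f ((X \<omega>, Y \<omega>), Z \<omega>'') \<partial>M \<partial>M)"
    proof -
      have "(\<lambda>p. \<integral>\<^sup>+\<omega>''. f ((snd p, fst p), Z \<omega>'') \<partial>M) \<in> borel_measurable (borel \<Otimes>\<^sub>M borel)" by measurable
      from indep_pair_nn_integral[OF YX this[unfolded borel_prod]] show ?thesis by simp
    qed
    finally show "(\<integral>\<^sup>+\<omega>. f ((X \<omega>, Y \<omega>), Z \<omega>) \<partial>M) = \<dots>" .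
  qed simp
qed

text \<open>First \<open>Z\<close> is separated from the pair, then \<open>Y\<close> from
  \<open>X\<close>, and finally \<open>Y\<close> and \<open>Z\<close> are reunited. This later makes
  the filtering error independent of innovation and mismatch errors jointly.\<close>

lemma (in prob_space) indep_pair_regroup:
  fixes X :: "'a \<Rightarrow> 'b::second_countable_topology" and Y :: "'a \<Rightarrow> 'c::second_countable_topology"
    and Z :: "'a \<Rightarrow> 'd::second_countable_topology"
  assumes XY: "indep_pair M X Y" and XYZ: "indep_pair M (\<lambda>\<omega>. (X \<omega>, Y \<omega>)) Z"
  shows "indep_pair M X (\<lambda>\<omega>. (Y \<omega>, Z \<omega>))"
proof -
  have [measurable]: "X \<in> borel_measurable M" "Y \<in> borel_measurable M" "Z \<in> borel_measurable M"
    using XY XYZ by (auto dest: indep_pair_measurable)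
  have YZ: "indep_pair M Y Z"
    using indep_pair_compose[OF XYZ, of snd "\<lambda>y. y"] by (simp add: borel_prod[symmetric])
  show ?thesis
    unfolding indep_pair_iff_nn_integral
  proof (intro conjI ballI)
    show "(\<lambda>\<omega>. (Y \<omega>, Z \<omega>)) \<in> borel_measurable M" unfolding borel_prod[symmetric] by simp
    fix f :: "'b \<times> ('c \<times> 'd) \<Rightarrow> ennreal" assume "f \<in> borel_measurable borel"
    then have [measurable]: "f \<in> borel_measurable (borel \<Otimes>\<^sub>M (borel \<Otimes>\<^sub>M borel))" by (simp add: borel_prod)
    have "(\<lambda>p. f (fst (fst p), (snd (fst p), snd p))) \<in> borel_measurable ((borel \<Otimes>\<^sub>M borel) \<Otimes>\<^sub>M borel)"
      by measurable
    from indep_pair_nn_integral[OF XYZ this[unfolded borel_prod]]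
    have "(\<integral>\<^sup>+\<omega>. f (X \<omega>, Y \<omega>, Z \<omega>) \<partial>M) = (\<integral>\<^sup>+\<omega>. \<integral>\<^sup>+\<omega>'. f (X \<omega>, Y \<omega>, Z \<omega>') \<partial>M \<partial>M)" by simp
    also have "\<dots> = (\<integral>\<^sup>+\<omega>. \<integral>\<^sup>+\<omega>'. \<integral>\<^sup>+\<omega>''. f (X \<omega>, Y \<omega>', Z \<omega>'') \<partial>M \<partial>M \<partial>M)"
    proof -
      have "(\<lambda>p. \<integral>\<^sup>+\<omega>''. f (fst p, snd p, Z \<omega>'') \<partial>M) \<in> borel_measurable (borel \<Otimes>\<^sub>M borel)" by measurable
      from indep_pair_nn_integral[OF XY this[unfolded borel_prod]] show ?thesis by simp
    qed
    also have "\<dots> = (\<integral>\<^sup>+\<omega>. \<integral>\<^sup>+\<omega>'. f (X \<omega>, Y \<omega>', Z \<omega>') \<partial>M \<partial>M)"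
    proof (rule nn_integral_cong)
      fix \<omega>
      have "(\<lambda>p. f (X \<omega>, p)) \<in> borel_measurable (borel \<Otimes>\<^sub>M borel)" by measurable
      from indep_pair_nn_integral[OF YZ this[unfolded borel_prod]]
      show "(\<integral>\<^sup>+\<omega>'. \<integral>\<^sup>+\<omega>''. f (X \<omega>, Y \<omega>', Z \<omega>'') \<partial>M \<partial>M) = (\<integral>\<^sup>+\<omega>'. f (X \<omega>, Y \<omega>', Z \<omega>') \<partial>M)" by simp
    qed
    finally show "(\<integral>\<^sup>+\<omega>. f (X \<omega>, Y \<omega>, Z \<omega>) \<partial>M) = \<dots>" .
  qed simp
qed

lemma (in prob_space) indep_pair_distr_eq:
  assumes XY: "indep_pair M X Y"
    and "f \<in> borel_measurable borel" "g \<in> borel_measurable borel"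
    and "distr M borel X = distr M borel (\<lambda>\<omega>. f (X \<omega>))" "distr M borel Y = distr M borel (\<lambda>\<omega>. g (Y \<omega>))"
  shows "distr M borel (\<lambda>\<omega>. (X \<omega>, Y \<omega>)) = distr M borel (\<lambda>\<omega>. (f (X \<omega>), g (Y \<omega>)))"
  using indep_pair_compose[OF XY assms(2,3)] XY assms(4,5) by (simp add: indep_pair_def)

lemma integral_distr_eq:
  fixes f :: "'b::topological_space \<Rightarrow> real"
  assumes "distr M borel X = distr M borel Y" "X \<in> borel_measurable M" "Y \<in> borel_measurable M"
    and "f \<in> borel_measurable borel"
  shows "(\<integral>\<omega>. f (X \<omega>) \<partial>M) = (\<integral>\<omega>. f (Y \<omega>) \<partial>M)"
  using assms by (metis integral_distr)

text \<open>Negating \<open>X\<close> preserves the joint law but reverses the integral. Cross terms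
  between a Gaussian vector and anything independent of it vanish in this way.\<close>

lemma (in prob_space) indep_pair_odd_integral_zero:
  fixes X :: "'a \<Rightarrow> 'b::{real_normed_vector,second_countable_topology}"
    and Y :: "'a \<Rightarrow> 'c::second_countable_topology" and f :: "'b \<times> 'c \<Rightarrow> real"
  assumes XY: "indep_pair M X Y" and sym: "distr M borel X = distr M borel (\<lambda>\<omega>. - X \<omega>)"
    and f: "f \<in> borel_measurable borel" and odd: "\<And>x y. f (- x, y) = - f (x, y)"
  shows "(\<integral>\<omega>. f (X \<omega>, Y \<omega>) \<partial>M) = 0"
proof -
  have [measurable]: "X \<in> borel_measurable M" "Y \<in> borel_measurable M"
    using XY by (auto dest: indep_pair_measurable)
  have m: "(\<lambda>\<omega>. (X \<omega>, Y \<omega>)) \<in> borel_measurable M" "(\<lambda>\<omega>. (- X \<omega>, Y \<omega>)) \<in> borel_measurable M"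
    unfolding borel_prod[symmetric] by simp_all
  have "distr M borel (\<lambda>\<omega>. (X \<omega>, Y \<omega>)) = distr M borel (\<lambda>\<omega>. (- X \<omega>, Y \<omega>))"
    using indep_pair_distr_eq[OF XY, of uminus "\<lambda>y. y"] sym by simp
  from integral_distr_eq[OF this m f] show ?thesis by (simp add: odd)
qed

text \<open>Grouping the indices into \<open>{i}\<close> and \<open>J\<close> turns the
  intersection-stable families into two independent sigma-algebras; the measures of rectangles then
  determine the joint law.\<close>

lemma (in prob_space) indep_sets_indep_pair:
  fixes X :: "'a \<Rightarrow> 'b::second_countable_topology" and Y :: "'a \<Rightarrow> 'c::second_countable_topology"
  assumes F: "indep_sets F UNIV" and st: "\<And>i. Int_stable (F i)" and i: "i \<notin> J"
    and Y: "Y \<in> borel_measurable (sigma (space M) (F i))"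
    and X: "X \<in> borel_measurable (sigma (space M) (\<Union>j\<in>J. F j))"
  shows "indep_pair M Y X"
proof -
  have ev: "F j \<subseteq> sets M" for j using F by (auto simp: indep_sets_def)
  have sub: "F j \<subseteq> Pow (space M)" for j using ev[of j] sets.sets_into_space by blast
  have sF: "sigma_sets (space M) (F i) \<subseteq> sets M" "sigma_sets (space M) (\<Union>j\<in>J. F j) \<subseteq> sets M"
    using ev by (auto intro!: sets.sigma_sets_subset)
  have Y1: "Y -` B \<inter> space M \<in> sigma_sets (space M) (F i)" if "B \<in> sets borel" for B
    using measurable_sets[OF Y that] sub by (simp add: space_measure_of_conv sets_measure_of)
  have X1: "X -` B \<inter> space M \<in> sigma_sets (space M) (\<Union>j\<in>J. F j)" if "B \<in> sets borel" for B
    using measurable_sets[OF X that] sub by (simp add: space_measure_of_conv sets_measure_of UN_subset_iff)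
  have YM[measurable]: "Y \<in> borel_measurable M"
    by (rule measurableI) (use Y1 sF in auto)
  have XM[measurable]: "X \<in> borel_measurable M"
    by (rule measurableI) (use X1 sF in auto)
  define I where "I b = (if b then {i} else J)" for b
  have ind: "indep_sets (\<lambda>b. sigma_sets (space M) (\<Union>j\<in>I b. F j)) UNIV"
    by (rule indep_sets_collect_sigma)
       (use F i st in \<open>auto simp: I_def disjoint_family_on_def intro: indep_sets_mono_index\<close>)
  have prod: "prob ((Y -` A \<inter> space M) \<inter> (X -` B \<inter> space M)) = prob (Y -` A \<inter> space M) * prob (X -` B \<inter> space M)"
    if "A \<in> sets borel" "B \<in> sets borel" for A B
    using indep_setsD[OF ind, of UNIV "\<lambda>b. if b then Y -` A \<inter> space M else X -` B \<inter> space M"]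
      Y1[OF that(1)] X1[OF that(2)]
    by (simp add: UNIV_bool I_def ac_simps)
  interpret DX: prob_space "distr M borel X" by (rule prob_space_distr) simp
  interpret DY: prob_space "distr M borel Y" by (rule prob_space_distr) simp
  have m: "(\<lambda>\<omega>. (Y \<omega>, X \<omega>)) \<in> measurable M borel"
    unfolding borel_prod[symmetric] by simp
  have "distr M borel Y \<Otimes>\<^sub>M distr M borel X = distr M borel (\<lambda>\<omega>. (Y \<omega>, X \<omega>))"
  proof (rule pair_measure_eqI)
    show "sigma_finite_measure (distr M borel Y)" "sigma_finite_measure (distr M borel X)"
      by unfold_locales
    show "sets (distr M borel Y \<Otimes>\<^sub>M distr M borel X) = sets (distr M borel (\<lambda>\<omega>. (Y \<omega>, X \<omega>)))"
      unfolding sets_distr by (subst borel_prod[symmetric], intro sets_pair_measure_cong) auto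
    fix A B assume "A \<in> sets (distr M borel Y)" "B \<in> sets (distr M borel X)"
    then have AB[measurable]: "A \<in> sets borel" "B \<in> sets borel" by auto
    then have "A \<times> B \<in> sets borel" unfolding borel_prod[symmetric] by simp
    moreover have "(\<lambda>\<omega>. (Y \<omega>, X \<omega>)) -` (A \<times> B) \<inter> space M = (Y -` A \<inter> space M) \<inter> (X -` B \<inter> space M)" by auto
    ultimately show "emeasure (distr M borel Y) A * emeasure (distr M borel X) B
      = emeasure (distr M borel (\<lambda>\<omega>. (Y \<omega>, X \<omega>))) (A \<times> B)"
      using prod[OF AB] m by (simp add: emeasure_distr emeasure_eq_measure ennreal_mult'')
  qed
  then show ?thesis by (simp add: indep_pair_def)
qed

section \<open>Positive definite matrices and the Gaussian measurement update\<close>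

lemma inner_matrix_transpose:
  fixes A :: "real^'n^'m"
  shows "x \<bullet> (A *v y) = (transpose A *v x) \<bullet> y"
  by (metis dot_lmul_matrix transpose_matrix_vector)

lemma pd_invertible:
  assumes "pd P" shows "P ** matrix_inv P = mat 1" "matrix_inv P ** P = mat 1"
    "transpose (matrix_inv P) = matrix_inv P"
proof -
  have "x = 0" if "P *v x = 0" for x
    using assms that unfolding pd_def by (metis inner_zero_right less_irrefl)
  then have "invertible P"
    using matrix_left_invertible_ker[of P] invertible_left_inverse[of P] by blast
  then have "\<exists>Q. P ** Q = mat 1 \<and> Q ** P = mat 1" by (simp add: invertible_def)
  from someI_ex[OF this] show *: "P ** matrix_inv P = mat 1" "matrix_inv P ** P = mat 1"
    by (auto simp: matrix_inv_def)
  have "transpose (matrix_inv P) ** P = mat 1"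
    using arg_cong[OF *(1), of transpose] assms by (simp add: matrix_transpose_mul transpose_mat pd_def)
  then show "transpose (matrix_inv P) = matrix_inv P"
    by (metis *(1) matrix_mul_assoc matrix_mul_lid matrix_mul_rid)
qed

lemma transpose_add: "transpose (A + B) = transpose A + transpose B"
  by (simp add: transpose_def vec_eq_iff)

lemma transpose_diff:
  fixes A B :: "real^'n^'m" shows "transpose (A - B) = transpose A - transpose B"
  by (simp add: transpose_def vec_eq_iff)

text \<open>Serves both the innovation covariance of the filter and, with \<open>transpose B\<close>
  for \<open>C\<close>, the matrix inverted in the Riccati recursion.\<close>

lemma pd_add_congruence:
  fixes C :: "real^'n^'m"
  assumes "psd P" "pd V"
  shows "pd (C ** P ** transpose C + V)"
  unfolding pd_def
proof (intro conjI allI impI)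
  show "transpose (C ** P ** transpose C + V) = C ** P ** transpose C + V"
    using assms by (simp add: transpose_add matrix_transpose_mul psd_def pd_def matrix_mul_assoc)
  fix x :: "real^'m" assume "x \<noteq> 0"
  then have "0 < x \<bullet> (V *v x)" using assms by (simp add: pd_def)
  moreover have "x \<bullet> ((C ** P ** transpose C) *v x) = (transpose C *v x) \<bullet> (P *v (transpose C *v x))"
    by (simp add: matrix_vector_mul_assoc[symmetric] inner_matrix_transpose[of x C])
  moreover have "0 \<le> (transpose C *v x) \<bullet> (P *v (transpose C *v x))" using assms by (simp add: psd_def)
  ultimately show "0 < x \<bullet> ((C ** P ** transpose C + V) *v x)"
    by (simp add: matrix_vector_mult_add_rdistrib inner_add_right)
qed

text \<open>A characteristic function is bounded by \<open>1\<close> in modulus, so the exponent is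
  never positive.\<close>

lemma (in prob_space) char_gauss_psd:
  assumes "char_gauss M X P" shows "psd P"
  unfolding psd_def
proof (intro conjI allI)
  show "transpose P = P" using assms by (simp add: char_gauss_def)
  have [measurable]: "X \<in> borel_measurable M" using assms by (simp add: char_gauss_def)
  fix a
  have "norm (CLINT \<omega>|M. iexp (a \<bullet> X \<omega>)) \<le> (\<integral>\<omega>. norm (iexp (a \<bullet> X \<omega>)) \<partial>M)"
    by (rule integral_norm_bound)
  also have "\<dots> = 1" by (simp add: prob_space)
  finally have "norm (complex_of_real (exp (- (a \<bullet> (P *v a)) / 2))) \<le> 1"
    using assms by (simp add: char_gauss_def)
  then show "0 \<le> a \<bullet> (P *v a)" by simp
qed

lemma (in prob_space) char_gauss_linear_add:
  fixes A :: "real^'n^'m"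
  assumes E: "char_gauss M E G" and w: "char_gauss M w W" and ind: "indep_pair M w E"
  shows "char_gauss M (\<lambda>\<omega>. A *v E \<omega> + w \<omega>) (A ** G ** transpose A + W)"
  unfolding char_gauss_def
proof (intro conjI allI)
  have [measurable]: "E \<in> borel_measurable M" "w \<in> borel_measurable M"
    using E w by (auto simp: char_gauss_def)
  show "(\<lambda>\<omega>. A *v E \<omega> + w \<omega>) \<in> borel_measurable M" by measurable
  show "transpose (A ** G ** transpose A + W) = A ** G ** transpose A + W"
    using E w by (simp add: transpose_add matrix_transpose_mul char_gauss_def matrix_mul_assoc)
  fix a
  have "(CLINT \<omega>|M. iexp (a \<bullet> (A *v E \<omega> + w \<omega>))) = (CLINT \<omega>|M. iexp (a \<bullet> w \<omega> + (transpose A *v a) \<bullet> E \<omega>))"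
    by (simp add: inner_add_right inner_matrix_transpose add.commute)
  also have "\<dots> = of_real (exp (- (a \<bullet> (W *v a)) / 2) * exp (- ((transpose A *v a) \<bullet> (G *v (transpose A *v a))) / 2))"
    unfolding indep_pair_char_mult[OF ind] using E w by (simp add: char_gauss_def)
  also have "exp (- (a \<bullet> (W *v a)) / 2) * exp (- ((transpose A *v a) \<bullet> (G *v (transpose A *v a))) / 2)
      = exp (- (a \<bullet> ((A ** G ** transpose A + W) *v a)) / 2)"
    by (simp add: exp_add[symmetric] matrix_vector_mult_add_rdistrib inner_add_right
        matrix_vector_mul_assoc[symmetric] inner_matrix_transpose[of a A] add_divide_distrib diff_divide_distrib)
  finally show "(CLINT \<omega>|M. iexp (a \<bullet> (A *v E \<omega> + w \<omega>)))
      = of_real (exp (- (a \<bullet> ((A ** G ** transpose A + W) *v a)) / 2))" .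
qed

text \<open>The Kalman gain is the choice for which the joint characteristic function of the
  remaining error and \<open>\<zeta>\<close> factors. Here \<open>\<zeta>\<close> is the correction
  of the estimate, with the gain already applied, whence its covariance
  \<open>K ** C ** P\<close>.\<close>

lemma (in prob_space) kalman_measurement_update:
  fixes C :: "real^'n^'p" and K :: "real^'p^'n" and P :: "real^'n^'n"
  assumes E: "char_gauss M E P" and v: "char_gauss M v V" and ind: "indep_pair M v E" and V: "pd V"
  defines "K \<equiv> P ** transpose C ** matrix_inv (C ** P ** transpose C + V)"
  defines "\<zeta> \<equiv> \<lambda>\<omega>. K *v (C *v E \<omega> + v \<omega>)"
  shows "char_gauss M (\<lambda>\<omega>. E \<omega> - \<zeta> \<omega>) (P - K ** C ** P)" "char_gauss M \<zeta> (K ** C ** P)"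
    "indep_pair M (\<lambda>\<omega>. E \<omega> - \<zeta> \<omega>) \<zeta>"
proof -
  have [measurable]: "E \<in> borel_measurable M" "v \<in> borel_measurable M"
    using E v by (auto simp: char_gauss_def)
  have [measurable]: "\<zeta> \<in> borel_measurable M" unfolding \<zeta>_def by measurable
  define \<Sigma> where "\<Sigma> = C ** P ** transpose C + V"
  define N where "N = K ** C ** P"
  have P: "psd P" by (rule char_gauss_psd[OF E])
  then have Ps: "transpose P = P" by (simp add: psd_def)
  have "pd \<Sigma>" unfolding \<Sigma>_def by (rule pd_add_congruence[OF P V])
  note \<Sigma> = pd_invertible[OF this]
  have K: "K = P ** transpose C ** matrix_inv \<Sigma>" by (simp add: K_def \<Sigma>_def)
  have Kt: "transpose K = matrix_inv \<Sigma> ** C ** P"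
    by (simp add: K matrix_transpose_mul \<Sigma> Ps matrix_mul_assoc)
  have N1: "P ** transpose C ** transpose K = N"
    by (simp add: N_def Kt) (simp add: K matrix_mul_assoc)
  have Ns: "transpose N = N"
    by (subst N1[symmetric]) (simp add: matrix_transpose_mul N_def Ps matrix_mul_assoc)
  have \<Sigma>K: "\<Sigma> ** transpose K = C ** P"
    by (simp add: Kt matrix_mul_assoc \<Sigma>)
  \<comment> \<open>This is the exponent of the joint characteristic function, with
    \<open>d = b - a\<close>: \<open>v\<close> is paired with \<open>h = transpose K *v d\<close>
    and \<open>E\<close> with \<open>a + transpose C *v h\<close>. Since
    \<open>P ** transpose C ** transpose K = N\<close>, the mixed terms complete to a form in
    \<open>a + d = b\<close> alone.\<close>
  have quad: "(a + transpose C *v (transpose K *v d)) \<bullet> (P *v (a + transpose C *v (transpose K *v d)))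
      + (transpose K *v d) \<bullet> (V *v (transpose K *v d))
    = a \<bullet> ((P - N) *v a) + (a + d) \<bullet> (N *v (a + d))" for a d
  proof -
    let ?h = "transpose K *v d"
    have 1: "a \<bullet> (P *v (transpose C *v ?h)) = a \<bullet> (N *v d)"
      by (simp add: matrix_vector_mul_assoc matrix_mul_assoc N1 del: transpose_matrix_vector)
    have 2: "(transpose C *v ?h) \<bullet> (P *v a) = a \<bullet> (P *v (transpose C *v ?h))"
      by (metis Ps inner_commute inner_matrix_transpose)
    have "(transpose C *v ?h) \<bullet> (P *v (transpose C *v ?h)) + ?h \<bullet> (V *v ?h) = ?h \<bullet> (\<Sigma> *v ?h)"
      by (simp add: \<Sigma>_def matrix_vector_mult_add_rdistrib inner_add_right matrix_vector_mul_assoc[symmetric]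
          inner_matrix_transpose[of ?h C] del: transpose_matrix_vector)
    also have "\<dots> = ?h \<bullet> ((C ** P) *v d)" by (simp add: matrix_vector_mul_assoc \<Sigma>K del: transpose_matrix_vector)
    also have "\<dots> = d \<bullet> (N *v d)"
      by (simp add: N_def matrix_vector_mul_assoc[symmetric] inner_matrix_transpose[of d K] del: transpose_matrix_vector)
    finally have 3: "(transpose C *v ?h) \<bullet> (P *v (transpose C *v ?h)) + ?h \<bullet> (V *v ?h) = d \<bullet> (N *v d)" .
    have 4: "d \<bullet> (N *v a) = a \<bullet> (N *v d)" by (metis Ns inner_commute inner_matrix_transpose)
    show ?thesis
      using 1 2 3 4 by (simp add: matrix_vector_right_distrib matrix_vector_mult_diff_rdistrib
          inner_add_left inner_add_right inner_diff_right del: transpose_matrix_vector)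
  qed
  have joint: "(CLINT \<omega>|M. iexp (a \<bullet> (E \<omega> - \<zeta> \<omega>) + b \<bullet> \<zeta> \<omega>))
    = of_real (exp (- (a \<bullet> ((P - N) *v a)) / 2) * exp (- (b \<bullet> (N *v b)) / 2))" for a b
  proof -
    let ?h = "transpose K *v (b - a)"
    have "a \<bullet> (E \<omega> - \<zeta> \<omega>) + b \<bullet> \<zeta> \<omega> = ?h \<bullet> v \<omega> + (a + transpose C *v ?h) \<bullet> E \<omega>" for \<omega>
    proof -
      have "a \<bullet> (E \<omega> - \<zeta> \<omega>) + b \<bullet> \<zeta> \<omega> = a \<bullet> E \<omega> + (b - a) \<bullet> \<zeta> \<omega>"
        by (simp add: inner_diff_left inner_diff_right)
      also have "(b - a) \<bullet> \<zeta> \<omega> = ?h \<bullet> (C *v E \<omega> + v \<omega>)"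
        unfolding \<zeta>_def by (rule inner_matrix_transpose)
      also have "\<dots> = (transpose C *v ?h) \<bullet> E \<omega> + ?h \<bullet> v \<omega>"
        by (simp add: inner_add_right inner_matrix_transpose[of ?h C] del: transpose_matrix_vector)
      finally show ?thesis by (simp add: inner_add_left)
    qed
    then have "(CLINT \<omega>|M. iexp (a \<bullet> (E \<omega> - \<zeta> \<omega>) + b \<bullet> \<zeta> \<omega>))
      = (CLINT \<omega>|M. iexp (?h \<bullet> v \<omega> + (a + transpose C *v ?h) \<bullet> E \<omega>))" by simp
    also have "\<dots> = of_real (exp (- (?h \<bullet> (V *v ?h)) / 2) *
        exp (- ((a + transpose C *v ?h) \<bullet> (P *v (a + transpose C *v ?h))) / 2))"
      unfolding indep_pair_char_mult[OF ind] using E v by (simp add: char_gauss_def)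
    also have "exp (- (?h \<bullet> (V *v ?h)) / 2) *
        exp (- ((a + transpose C *v ?h) \<bullet> (P *v (a + transpose C *v ?h))) / 2)
       = exp (- (a \<bullet> ((P - N) *v a)) / 2) * exp (- (b \<bullet> (N *v b)) / 2)"
    proof -
      have "(?h \<bullet> (V *v ?h)) + ((a + transpose C *v ?h) \<bullet> (P *v (a + transpose C *v ?h)))
        = a \<bullet> ((P - N) *v a) + b \<bullet> (N *v b)"
        using quad[of a "b - a"] by simp
      then show ?thesis unfolding exp_add[symmetric] by (simp add: field_simps)
    qed
    finally show ?thesis .
  qed
  have c1: "(CLINT \<omega>|M. iexp (a \<bullet> (E \<omega> - \<zeta> \<omega>))) = of_real (exp (- (a \<bullet> ((P - N) *v a)) / 2))" for a
    using joint[of a 0] by simp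
  have c2: "(CLINT \<omega>|M. iexp (b \<bullet> \<zeta> \<omega>)) = of_real (exp (- (b \<bullet> (N *v b)) / 2))" for b
    using joint[of 0 b] by simp
  show "char_gauss M (\<lambda>\<omega>. E \<omega> - \<zeta> \<omega>) (P - K ** C ** P)" "char_gauss M \<zeta> (K ** C ** P)"
    using c1 c2 Ns Ps unfolding char_gauss_def N_def[symmetric] by (auto simp: transpose_diff)
  show "indep_pair M (\<lambda>\<omega>. E \<omega> - \<zeta> \<omega>) \<zeta>"
    by (rule char_factor_imp_indep_pair) (simp_all only: joint c1 c2 of_real_mult, auto)
qed

section \<open>Square-integrable vectors and the Riccati recursion\<close>

lemma square_integrable_bound:
  assumes "X \<in> borel_measurable M" "integrable M f" "\<And>\<omega>. (norm (X \<omega>))\<^sup>2 \<le> f \<omega>"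
  shows "square_integrable M X"
  unfolding square_integrable_def
proof
  show "integrable M (\<lambda>\<omega>. (norm (X \<omega>))\<^sup>2)"
    by (rule Bochner_Integration.integrable_bound[OF assms(2)])
       (use assms(1,3) in \<open>auto intro: order_trans[OF _ abs_ge_self]\<close>)
qed fact

lemma square_integrable_add:
  assumes "square_integrable M X" "square_integrable M Y"
  shows "square_integrable M (\<lambda>\<omega>. X \<omega> + Y \<omega>)"
proof (rule square_integrable_bound)
  have [measurable]: "X \<in> borel_measurable M" "Y \<in> borel_measurable M"
    using assms by (auto simp: square_integrable_def)
  show "(\<lambda>\<omega>. X \<omega> + Y \<omega>) \<in> borel_measurable M" by simp
  show "integrable M (\<lambda>\<omega>. 2 * (norm (X \<omega>))\<^sup>2 + 2 * (norm (Y \<omega>))\<^sup>2)"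
    using assms by (auto simp: square_integrable_def)
  fix \<omega>
  have "(norm (X \<omega> + Y \<omega>))\<^sup>2 \<le> (norm (X \<omega>) + norm (Y \<omega>))\<^sup>2"
    by (intro power_mono norm_triangle_ineq) simp
  also have "\<dots> \<le> 2 * (norm (X \<omega>))\<^sup>2 + 2 * (norm (Y \<omega>))\<^sup>2"
    using sum_squares_bound[of "norm (X \<omega>)" "norm (Y \<omega>)"] by (simp add: power2_sum)
  finally show "(norm (X \<omega> + Y \<omega>))\<^sup>2 \<le> 2 * (norm (X \<omega>))\<^sup>2 + 2 * (norm (Y \<omega>))\<^sup>2" .
qed

lemma square_integrable_matrix:
  fixes A :: "real^'n^'m"
  assumes "square_integrable M X"
  shows "square_integrable M (\<lambda>\<omega>. A *v X \<omega>)"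
proof (rule square_integrable_bound)
  have [measurable]: "X \<in> borel_measurable M"
    using assms by (auto simp: square_integrable_def)
  show "(\<lambda>\<omega>. A *v X \<omega>) \<in> borel_measurable M" by measurable
  show "integrable M (\<lambda>\<omega>. (onorm ((*v) A))\<^sup>2 * (norm (X \<omega>))\<^sup>2)"
    using assms by (auto simp: square_integrable_def)
  fix \<omega>
  have "norm (A *v X \<omega>) \<le> onorm ((*v) A) * norm (X \<omega>)"
    by (rule onorm) (simp add: linear_conv_bounded_linear[symmetric])
  then show "(norm (A *v X \<omega>))\<^sup>2 \<le> (onorm ((*v) A))\<^sup>2 * (norm (X \<omega>))\<^sup>2"
    unfolding power_mult_distrib[symmetric] by (intro power_mono) auto
qed

lemma square_integrable_uminus:
  "square_integrable M X \<Longrightarrow> square_integrable M (\<lambda>\<omega>. - X \<omega>)"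
  by (simp add: square_integrable_def)

lemma square_integrable_diff:
  "square_integrable M X \<Longrightarrow> square_integrable M Y \<Longrightarrow> square_integrable M (\<lambda>\<omega>. X \<omega> - Y \<omega>)"
  using square_integrable_add[OF _ square_integrable_uminus] by fastforce

lemma square_integrable_zero: "square_integrable M (\<lambda>\<omega>. 0)"
  by (simp add: square_integrable_def)

lemma square_integrable_if:
  assumes "square_integrable M X" "square_integrable M Y" and [measurable]: "Measurable.pred M P"
  shows "square_integrable M (\<lambda>\<omega>. if P \<omega> then X \<omega> else Y \<omega>)"
proof (rule square_integrable_bound)
  have [measurable]: "X \<in> borel_measurable M" "Y \<in> borel_measurable M"
    using assms by (auto simp: square_integrable_def)
  show "(\<lambda>\<omega>. if P \<omega> then X \<omega> else Y \<omega>) \<in> borel_measurable M" by measurable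
  show "integrable M (\<lambda>\<omega>. (norm (X \<omega>))\<^sup>2 + (norm (Y \<omega>))\<^sup>2)"
    using assms by (auto simp: square_integrable_def)
qed auto

lemma square_integrable_sum:
  "(\<And>i. i \<in> I \<Longrightarrow> square_integrable M (X i)) \<Longrightarrow> square_integrable M (\<lambda>\<omega>. \<Sum>i\<in>I. X i \<omega>)"
  by (induction I rule: infinite_finite_induct) (auto intro: square_integrable_zero square_integrable_add)

lemma square_integrable_inner:
  assumes "square_integrable M X" "square_integrable M Y"
  shows "integrable M (\<lambda>\<omega>. X \<omega> \<bullet> Y \<omega>)"
proof (rule Bochner_Integration.integrable_bound)
  have [measurable]: "X \<in> borel_measurable M" "Y \<in> borel_measurable M"
    using assms by (auto simp: square_integrable_def)
  show "integrable M (\<lambda>\<omega>. (norm (X \<omega>))\<^sup>2 + (norm (Y \<omega>))\<^sup>2)"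
    using assms by (auto simp: square_integrable_def)
  show "(\<lambda>\<omega>. X \<omega> \<bullet> Y \<omega>) \<in> borel_measurable M" by measurable
  have "\<bar>x \<bullet> y\<bar> \<le> (norm x)\<^sup>2 + (norm y)\<^sup>2" for x y :: 'b
    using Cauchy_Schwarz_ineq2[of x y] sum_squares_bound[of "norm x" "norm y"]
      mult_nonneg_nonneg[OF norm_ge_zero[of x] norm_ge_zero[of y]]
    by linarith
  then show "AE \<omega> in M. norm (X \<omega> \<bullet> Y \<omega>) \<le> norm ((norm (X \<omega>))\<^sup>2 + (norm (Y \<omega>))\<^sup>2)"
    by auto
qed

lemma square_integrable_quadratic:
  fixes A :: "real^'n^'n"
  shows "square_integrable M X \<Longrightarrow> square_integrable M Y \<Longrightarrow> integrable M (\<lambda>\<omega>. X \<omega> \<bullet> (A *v Y \<omega>))"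
  by (intro square_integrable_inner square_integrable_matrix)

lemmas square_integrable_intros = square_integrable_add square_integrable_matrix square_integrable_uminus
  square_integrable_diff square_integrable_zero square_integrable_if square_integrable_sum

section \<open>Completing the square along the Riccati recursion\<close>

lemma symmetric_inner_swap:
  fixes S :: "real^'n^'n"
  assumes "transpose S = S" shows "x \<bullet> (S *v y) = y \<bullet> (S *v x)"
  by (metis assms inner_commute inner_matrix_transpose)

lemma quadratic_add:
  fixes S :: "real^'n^'n"
  assumes "transpose S = S"
  shows "(x + y) \<bullet> (S *v (x + y)) = x \<bullet> (S *v x) + 2 * (x \<bullet> (S *v y)) + y \<bullet> (S *v y)"
  using symmetric_inner_swap[OF assms, of y x]
  by (simp add: matrix_vector_right_distrib inner_add_left inner_add_right)

lemma psd_sandwich: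
  fixes P :: "real^'m^'m" and C :: "real^'n^'m"
  assumes "psd P" shows "psd (transpose C ** P ** C)"
  unfolding psd_def
proof (intro conjI allI)
  show "transpose (transpose C ** P ** C) = transpose C ** P ** C"
    using assms by (simp add: psd_def matrix_transpose_mul matrix_mul_assoc)
  fix x
  have "x \<bullet> ((transpose C ** P ** C) *v x) = (C *v x) \<bullet> (P *v (C *v x))"
    by (simp add: matrix_vector_mul_assoc[symmetric] inner_matrix_transpose[of x "transpose C"] del: transpose_matrix_vector)
  then show "0 \<le> x \<bullet> ((transpose C ** P ** C) *v x)" using assms by (simp add: psd_def)
qed

lemma pd_imp_psd: "pd P \<Longrightarrow> psd P"
  unfolding pd_def psd_def by (metis inner_zero_left order_le_less)

lemma pd_riccati_weight:
  fixes B :: "real^'m^'n"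
  assumes "psd S" "pd R" shows "pd (R + transpose B ** S ** B)"
  using pd_add_congruence[OF assms, of "transpose B"] by (simp add: add.commute)

lemma riccati_complete_square:
  fixes A :: "real^'n^'n" and B :: "real^'m^'n"
  assumes S: "psd S" and R: "pd R"
  defines "W \<equiv> R + transpose B ** S ** B"
  defines "K \<equiv> matrix_inv W ** transpose B ** S ** A"
  shows "x \<bullet> (Q *v x) + u \<bullet> (R *v u) + (A *v x + B *v u) \<bullet> (S *v (A *v x + B *v u))
    = x \<bullet> ((Q + transpose A ** (S - S ** B ** matrix_inv W ** transpose B ** S) ** A) *v x)
      + (u + K *v x) \<bullet> (W *v (u + K *v x))"
proof -
  have W: "pd W" unfolding W_def by (rule pd_riccati_weight[OF S R])
  then have Ws: "transpose W = W" by (simp add: pd_def)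
  have Ss: "transpose S = S" using S by (simp add: psd_def)
  \<comment> \<open>Normal equation of the minimising control \<open>- (K *v x)\<close>: it matches
    the terms linear in \<open>u\<close> on both sides.\<close>
  have WK: "W *v (K *v x) = transpose B *v (S *v (A *v x))"
    using pd_invertible(1)[OF W]
    by (simp add: K_def matrix_vector_mul_assoc matrix_mul_assoc del: transpose_matrix_vector)
  have Bu: "u \<bullet> (transpose B *v y) = (B *v u) \<bullet> y" for u y
    by (simp add: inner_matrix_transpose[of u "transpose B"] del: transpose_matrix_vector)
  have uWu: "u \<bullet> (W *v u) = u \<bullet> (R *v u) + (B *v u) \<bullet> (S *v (B *v u))"
    by (simp add: W_def matrix_vector_mult_add_rdistrib inner_add_right matrix_vector_mul_assoc[symmetric] Bu
        del: transpose_matrix_vector)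
  have "x \<bullet> ((transpose A ** (S - S ** B ** matrix_inv W ** transpose B ** S) ** A) *v x)
     = (A *v x) \<bullet> ((S - S ** B ** matrix_inv W ** transpose B ** S) *v (A *v x))"
    by (simp add: matrix_vector_mul_assoc[symmetric] inner_matrix_transpose[of x "transpose A"]
        del: transpose_matrix_vector)
  also have "\<dots> = (A *v x) \<bullet> (S *v (A *v x)) - (A *v x) \<bullet> (S *v (B *v (K *v x)))"
    unfolding matrix_vector_mult_diff_rdistrib inner_diff_right
    by (simp add: K_def matrix_vector_mul_assoc matrix_mul_assoc
        del: transpose_matrix_vector)
  finally have 1: "x \<bullet> ((transpose A ** (S - S ** B ** matrix_inv W ** transpose B ** S) ** A) *v x)
     = (A *v x) \<bullet> (S *v (A *v x)) - (A *v x) \<bullet> (S *v (B *v (K *v x)))" .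
  have 2: "(u + K *v x) \<bullet> (W *v (u + K *v x)) = u \<bullet> (R *v u) + (B *v u) \<bullet> (S *v (B *v u))
     + 2 * ((B *v u) \<bullet> (S *v (A *v x))) + (B *v (K *v x)) \<bullet> (S *v (A *v x))"
    unfolding quadratic_add[OF Ws] WK uWu Bu by simp
  have 3: "(B *v (K *v x)) \<bullet> (S *v (A *v x)) = (A *v x) \<bullet> (S *v (B *v (K *v x)))"
    "(B *v u) \<bullet> (S *v (A *v x)) = (A *v x) \<bullet> (S *v (B *v u))"
    by (rule symmetric_inner_swap[OF Ss])+
  show ?thesis
    unfolding quadratic_add[OF Ss] matrix_vector_mult_add_rdistrib inner_add_right 1 2 3 by simp
qed

text \<open>For the minimising control the completed square is zero, so the form is a sum of
  nonnegative stage costs. Semidefiniteness in turn makes the matrix inverted in the next step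
  positive definite.\<close>

lemma psd_Sback:
  assumes "lqg_wf s" shows "psd (Sback s n)"
proof (induction n)
  case 0
  then show ?case using assms by (simp add: lqg_wf_def)
next
  case (Suc n)
  have wf: "psd (sQ s)" "pd (sR s)" using assms by (auto simp: lqg_wf_def)
  let ?S = "Sback s n" let ?W = "sR s + transpose (sB s) ** ?S ** sB s"
  have Ss: "transpose ?S = ?S" using Suc by (simp add: psd_def)
  note Winv = pd_invertible[OF pd_riccati_weight[OF Suc wf(2), of "sB s"]]
  show ?case
    unfolding psd_def
  proof (intro conjI allI)
    show "transpose (Sback s (Suc n)) = Sback s (Suc n)"
      using wf by (simp add: Let_def transpose_add transpose_diff matrix_transpose_mul Ss Winv psd_def matrix_mul_assoc)
    fix x
    define u where "u = - ((matrix_inv ?W ** transpose (sB s) ** ?S ** sA s) *v x)"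
    have "x \<bullet> (Sback s (Suc n) *v x)
      = x \<bullet> (sQ s *v x) + u \<bullet> (sR s *v u) + (sA s *v x + sB s *v u) \<bullet> (?S *v (sA s *v x + sB s *v u))"
      unfolding riccati_complete_square[OF Suc wf(2)] by (simp add: Let_def u_def)
    also have "\<dots> \<ge> 0"
      using Suc wf pd_imp_psd[OF wf(2)] by (simp add: psd_def)
    finally show "0 \<le> x \<bullet> (Sback s (Suc n) *v x)" .
  qed
qed

lemma psd_Gam:
  assumes "lqg_wf s" shows "psd (Gam s T k)"
proof (cases "k < T")
  case True
  have "pd (sR s + transpose (sB s) ** Sric s T (Suc k) ** sB s)"
    using psd_Sback[OF assms] assms by (intro pd_riccati_weight) (auto simp: Sric_def lqg_wf_def)
  from psd_sandwich[OF pd_imp_psd[OF this]] True show ?thesis by (simp add: Gam_def Let_def)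
next
  case False
  then show ?thesis by (simp add: Gam_def psd_def transpose_def vec_eq_iff)
qed

text \<open>For the control computed from \<open>y\<close> the completed square is that of the gain
  applied to \<open>x - y\<close>: acting on an estimate costs exactly the \<open>Gam\<close> form
  of its error.\<close>

lemma lqg_complete_square:
  assumes wf: "lqg_wf s" and k: "k < T"
  shows "x \<bullet> (sQ s *v x) + (- (Lgain s T k *v y)) \<bullet> (sR s *v (- (Lgain s T k *v y)))
     + (sA s *v x + sB s *v (- (Lgain s T k *v y))) \<bullet> (Sric s T (Suc k) *v (sA s *v x + sB s *v (- (Lgain s T k *v y))))
   = x \<bullet> (Sric s T k *v x) + (x - y) \<bullet> (Gam s T k *v (x - y))"
proof -
  let ?S = "Sric s T (Suc k)" let ?W = "sR s + transpose (sB s) ** ?S ** sB s" let ?L = "Lgain s T k"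
  have S: "psd ?S" and R: "pd (sR s)"
    using psd_Sback[OF wf] wf by (auto simp: Sric_def lqg_wf_def)
  have Sk: "Sric s T k = sQ s + transpose (sA s) ** (?S - ?S ** sB s ** matrix_inv ?W ** transpose (sB s) ** ?S) ** sA s"
    using k by (simp add: Sric_def Let_def Suc_diff_Suc[symmetric])
  have L: "?L = matrix_inv ?W ** transpose (sB s) ** ?S ** sA s" by (simp add: Lgain_def Let_def)
  have G: "(x - y) \<bullet> (Gam s T k *v (x - y)) = (?L *v (x - y)) \<bullet> (?W *v (?L *v (x - y)))"
    using k by (simp add: Gam_def Let_def matrix_vector_mul_assoc[symmetric]
        inner_matrix_transpose[of _ "transpose ?L"] del: transpose_matrix_vector)
  have d: "- (?L *v y) + ?L *v x = ?L *v (x - y)" by (simp add: matrix_vector_mult_diff_distrib)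
  show ?thesis
    using riccati_complete_square[OF S R, of x "sQ s" "- (?L *v y)" "sA s" "sB s"]
    unfolding Sk[symmetric] L[symmetric] d G .
qed

lemma inner_mpow_quadratic:
  fixes A :: "real^'n^'n"
  shows "y \<bullet> ((transpose (mpow A m) ** G ** mpow A m) *v y) = (mpow A m *v y) \<bullet> (G *v (mpow A m *v y))"
  by (simp add: matrix_vector_mul_assoc[symmetric] inner_matrix_transpose[of _ "transpose (mpow A m)"]
      del: transpose_matrix_vector)

lemma mpow_Suc_right: "mpow A (Suc n) = mpow A n ** A"
  by (induction n) (simp_all add: matrix_mul_assoc)

section \<open>The closed loop\<close>

declare Kgain.simps [simp del] Ppred.simps [simp del]

text \<open>Error of the one-step prediction as a recursion in the noises alone. The control enters
  state and prediction alike and cancels, so the process is the same for every scheduling rule. It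
  starts at \<open>x0\<close> because the first prediction is zero.\<close>

primrec pred_err :: "('n::finite,'m::finite,'p::finite) lqg \<Rightarrow> ('a \<Rightarrow> real^'n) \<Rightarrow> (nat \<Rightarrow> 'a \<Rightarrow> real^'n)
    \<Rightarrow> (nat \<Rightarrow> 'a \<Rightarrow> real^'p) \<Rightarrow> nat \<Rightarrow> 'a \<Rightarrow> real^'n" where
  "pred_err s x0 w v 0 = x0"
| "pred_err s x0 w v (Suc k) = (\<lambda>\<omega>. sA s *v (pred_err s x0 w v k \<omega>
      - Kgain s k *v (sC s *v pred_err s x0 w v k \<omega> + v k \<omega>)) + w k \<omega>)"

definition innov :: "('n::finite,'m::finite,'p::finite) lqg \<Rightarrow> ('a \<Rightarrow> real^'n) \<Rightarrow> (nat \<Rightarrow> 'a \<Rightarrow> real^'n)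
    \<Rightarrow> (nat \<Rightarrow> 'a \<Rightarrow> real^'p) \<Rightarrow> nat \<Rightarrow> 'a \<Rightarrow> real^'n" where
  "innov s x0 w v k \<omega> = Kgain s k *v (sC s *v pred_err s x0 w v k \<omega> + v k \<omega>)"

definition filter_err :: "('n::finite,'m::finite,'p::finite) lqg \<Rightarrow> ('a \<Rightarrow> real^'n) \<Rightarrow> (nat \<Rightarrow> 'a \<Rightarrow> real^'n)
    \<Rightarrow> (nat \<Rightarrow> 'a \<Rightarrow> real^'p) \<Rightarrow> nat \<Rightarrow> 'a \<Rightarrow> real^'n" where
  "filter_err s x0 w v k \<omega> = pred_err s x0 w v k \<omega> - innov s x0 w v k \<omega>"

lemma pred_err_Suc: "pred_err s x0 w v (Suc k) = (\<lambda>\<omega>. sA s *v filter_err s x0 w v k \<omega> + w k \<omega>)"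
  by (simp add: filter_err_def innov_def)

text \<open>Coordinate \<open>j\<close> is the mismatch error of scheduler \<open>j + 1\<close>, whereas \<open>D j\<close> is the decision rule
  of scheduler \<open>j\<close>.\<close>

definition mismatch_step :: "real^'n^'n \<Rightarrow> (nat \<Rightarrow> real^'n \<Rightarrow> bool) \<Rightarrow> real^'n \<Rightarrow> (nat \<Rightarrow> real^'n) \<Rightarrow> nat \<Rightarrow> real^'n" where
  "mismatch_step A D \<zeta> z j = (case j of
      0 \<Rightarrow> (if D 1 (z 0) then 0 else A *v z 0) + \<zeta>
    | Suc i \<Rightarrow> (if D (i + 1) (z i) then A *v z i else 0) + (if D (i + 2) (z (Suc i)) then 0 else A *v z (Suc i)))"

definition flip :: "nat \<Rightarrow> (nat \<Rightarrow> real^'n) \<Rightarrow> nat \<Rightarrow> real^'n" where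
  "flip p z j = (if j < p then - z j else z j)"

lemma matrix_vector_mult_uminus: "(A :: real^'n^'m) *v (- x) = - (A *v x)"
  using matrix_vector_mult_scaleR[of A "-1" x] by simp

lemma flip_0: "flip 0 z = z"
  by (rule ext) (simp add: flip_def)

text \<open>A transmission by scheduler \<open>q + 1\<close> moves the boundary between flipped and unflipped
  coordinates by one.\<close>

lemma flip_mismatch_step:
  assumes even: "\<And>j z. D j (- z) = D j z"
  shows "flip (Suc q) (mismatch_step A D \<zeta> z)
    = mismatch_step A D (- \<zeta>) (if D (Suc q) (z q) then flip q z else flip (Suc q) z)"
proof
  fix j
  show "flip (Suc q) (mismatch_step A D \<zeta> z) j
    = mismatch_step A D (- \<zeta>) (if D (Suc q) (z q) then flip q z else flip (Suc q) z) j"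
  proof (cases j)
    case 0
    then show ?thesis
      by (cases "q = 0") (auto simp: flip_def mismatch_step_def even matrix_vector_mult_uminus)
  next
    case (Suc i)
    \<comment> \<open>Below the edge both sources are negated, above it neither. At
      \<open>Suc i = q\<close> the withheld source \<open>z q\<close> contributes only without a
      transmission, when it is negated; at \<open>i = q\<close> the same \<open>z q\<close>
      contributes only when transmitted, and then it is not negated.\<close>
    consider "Suc i < q" | "Suc i = q" | "i = q" | "q < i" by linarith
    then show ?thesis
      by cases (auto simp: Suc flip_def mismatch_step_def even matrix_vector_mult_uminus)
  qed
qed

lemma borel_measurable_flip: "flip p \<in> borel_measurable borel"
  unfolding flip_def[abs_def] by (rule measurable_coordinatewise_then_product) measurable

lemma borel_measurable_mismatch_step:
  fixes A :: "real^'n^'n"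
  assumes [measurable]: "\<And>j. Measurable.pred borel (D j)"
  shows "(\<lambda>p. mismatch_step A D (fst p) (snd p)) \<in> borel_measurable borel"
proof (rule measurable_coordinatewise_then_product)
  fix j
  have [measurable]: "(\<lambda>p::(real^'n) \<times> (nat \<Rightarrow> real^'n). snd p i) \<in> borel_measurable (borel \<Otimes>\<^sub>M borel)" for i
    by (rule measurable_compose[OF measurable_snd measurable_product_coordinates])
  show "(\<lambda>p. mismatch_step A D (fst p) (snd p) j) \<in> borel_measurable borel"
  proof (cases j)
    case 0
    then show ?thesis unfolding borel_prod[symmetric] mismatch_step_def by simp
  next
    case (Suc i)
    then show ?thesis unfolding borel_prod[symmetric] mismatch_step_def by simp
  qed
qed

text \<open>Common frame for the two policies. Evenness of \<open>D\<close> makes decisions blind to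
  the sign changes under which the law of the mismatch errors will be invariant.\<close>

locale even_scheduling = prob_space M
  for M :: "'a measure" +
  fixes s :: "('n::finite,'m::finite,'p::finite) lqg"
    and x0 :: "'a \<Rightarrow> real^'n" and w :: "nat \<Rightarrow> 'a \<Rightarrow> real^'n" and v :: "nat \<Rightarrow> 'a \<Rightarrow> real^'p"
    and T L :: nat and D :: "nat \<Rightarrow> nat \<Rightarrow> real^'n \<Rightarrow> bool"
    and sched :: "nat \<Rightarrow> nat \<Rightarrow> (nat \<Rightarrow> real^'n) \<Rightarrow> bool"
  assumes wf: "lqg_wf s" and noise: "lqg_noise M s x0 w v"
    and D_even: "D k j (- z) = D k j z" and D_meas [measurable]: "Measurable.pred borel (D k j)"
    and sched: "sched k j est = D k j (est j - est (j + 1))"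
begin

definition "st k \<omega> = cl_x s T L sched x0 w v k \<omega>"
definition "est k \<omega> = cl_xh s T L sched x0 w v k \<omega>"
definition "mis k \<omega> j = est k \<omega> (j + 1) - est k \<omega> (j + 2)"
definition "ctl k \<omega> = - (Lgain s T k *v est k \<omega> (L + 1))"

abbreviation "ferr \<equiv> filter_err s x0 w v"
abbreviation "perr \<equiv> pred_err s x0 w v"
abbreviation "inn \<equiv> innov s x0 w v"

lemma st_0: "st 0 \<omega> = x0 \<omega>"
  by (simp add: st_def cl_x_def Let_def)

lemma st_Suc: "st (Suc k) \<omega> = sA s *v st k \<omega> + sB s *v ctl k \<omega> + w k \<omega>"
  by (simp add: st_def est_def ctl_def cl_x_def cl_xh_def Let_def split_beta)

lemma est_0: "est 0 \<omega> j = (if j = 1 then inn 0 \<omega> else 0)"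
  by (simp add: est_def cl_xh_def Let_def innov_def)

lemma est_Suc: "est (Suc k) \<omega> j = (let pr = sA s *v est k \<omega> 1 + sB s *v ctl k \<omega> in
    if j = 1 then pr + Kgain s (Suc k) *v (sC s *v st (Suc k) \<omega> + v (Suc k) \<omega> - sC s *v pr)
    else if D k (j - 1) (est k \<omega> (j - 1) - est k \<omega> (j - 1 + 1)) then sA s *v est k \<omega> (j - 1) + sB s *v ctl k \<omega>
    else sA s *v est k \<omega> j + sB s *v ctl k \<omega>)"
  by (simp add: st_def est_def ctl_def cl_x_def cl_xh_def Let_def split_beta sched)

text \<open>Scheduler 1 receives every measurement and knows the control, so its error obeys the
  control-free recursion.\<close>

lemma st_est: "st k \<omega> - est k \<omega> 1 = ferr k \<omega>"
proof (induction k)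
  case 0
  then show ?case by (simp add: st_0 est_0 filter_err_def)
next
  case (Suc k)
  let ?pr = "sA s *v est k \<omega> 1 + sB s *v ctl k \<omega>"
  have pe: "st (Suc k) \<omega> - ?pr = perr (Suc k) \<omega>"
    unfolding pred_err_Suc st_Suc Suc[symmetric] by (simp add: matrix_vector_mult_diff_distrib)
  have e: "sC s *v st (Suc k) \<omega> + v (Suc k) \<omega> - sC s *v ?pr = sC s *v (st (Suc k) \<omega> - ?pr) + v (Suc k) \<omega>"
    by (simp add: matrix_vector_mult_diff_distrib)
  have "est (Suc k) \<omega> 1 = ?pr + Kgain s (Suc k) *v (sC s *v st (Suc k) \<omega> + v (Suc k) \<omega> - sC s *v ?pr)"
    unfolding est_Suc Let_def by (simp only: if_True refl)
  then have "est (Suc k) \<omega> 1 = ?pr + inn (Suc k) \<omega>"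
    unfolding e innov_def pe .
  then show ?case unfolding filter_err_def pe[symmetric] by simp
qed

lemma est_1_Suc: "est (Suc k) \<omega> 1 = sA s *v est k \<omega> 1 + sB s *v ctl k \<omega> + inn (Suc k) \<omega>"
proof -
  have "est (Suc k) \<omega> 1 = st (Suc k) \<omega> - ferr (Suc k) \<omega>"
    using st_est[of "Suc k" \<omega>] by (simp add: algebra_simps)
  also have "\<dots> = st (Suc k) \<omega> - (sA s *v ferr k \<omega> + w k \<omega>) + inn (Suc k) \<omega>"
    by (simp add: filter_err_def[of _ _ _ _ "Suc k"] pred_err_Suc del: pred_err.simps)
  also have "\<dots> = sA s *v est k \<omega> 1 + sB s *v ctl k \<omega> + inn (Suc k) \<omega>"
    unfolding st_Suc st_est[symmetric] by (simp add: matrix_vector_mult_diff_distrib)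
  finally show ?thesis .
qed

lemma mis_0: "mis 0 \<omega> = (\<lambda>j. if j = 0 then inn 0 \<omega> else 0)"
  by (rule ext) (simp add: mis_def est_0)

text \<open>All nodes add the same control term, which cancels in differences. A transmission gives
  the receiver the propagated estimate of the sender and thereby shifts the mismatch error by one
  coordinate.\<close>

lemma mis_Suc: "mis (Suc k) \<omega> = mismatch_step (sA s) (D k) (inn (Suc k) \<omega>) (mis k \<omega>)"
proof
  fix j
  have est_ge: "est (Suc k) \<omega> (Suc (Suc i)) =
    (if D k (Suc i) (mis k \<omega> i) then sA s *v est k \<omega> (Suc i) else sA s *v est k \<omega> (Suc (Suc i))) + sB s *v ctl k \<omega>" for i
    unfolding est_Suc by (simp add: Let_def mis_def)
  show "mis (Suc k) \<omega> j = mismatch_step (sA s) (D k) (inn (Suc k) \<omega>) (mis k \<omega>) j"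
  proof (cases j)
    case 0
    show ?thesis
      using est_1_Suc[of k \<omega>] est_ge[of 0]
      by (simp add: 0 mis_def[of "Suc k"] mismatch_step_def) (simp add: mis_def matrix_vector_mult_diff_distrib numeral_2_eq_2)
  next
    case (Suc i)
    show ?thesis
      using est_ge[of i] est_ge[of "Suc i"]
      by (simp add: Suc mis_def[of "Suc k"] mismatch_step_def) (simp add: mis_def matrix_vector_mult_diff_distrib)
  qed
qed

lemma est_diff: "est k \<omega> 1 - est k \<omega> (L + 1) = (\<Sum>j<L. mis k \<omega> j)"
proof -
  have "est k \<omega> 1 - est k \<omega> (n + 1) = (\<Sum>j<n. mis k \<omega> j)" for n
    by (induction n) (simp_all add: mis_def algebra_simps)
  then show ?thesis .
qed

text \<open>\<open>N\<close> is arbitrary so that adaptedness follows as well: it will be the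
  sigma-algebra of an initial part of the noises, and the index bounds tell which noises have
  entered by time \<open>k\<close>.\<close>

lemma borel_measurable_errs:
  assumes "x0 \<in> borel_measurable N" "\<And>i. i < k \<Longrightarrow> w i \<in> borel_measurable N"
    "\<And>i. i < k \<Longrightarrow> v i \<in> borel_measurable N"
  shows "perr k \<in> borel_measurable N"
  using assms
proof (induction k)
  case (Suc k)
  have [measurable]: "perr k \<in> borel_measurable N" "w k \<in> borel_measurable N" "v k \<in> borel_measurable N"
    using Suc by auto
  show ?case by (simp, measurable)
qed simp

lemma borel_measurable_loop:
  assumes "x0 \<in> borel_measurable N" "\<And>i. i < k \<Longrightarrow> w i \<in> borel_measurable N"
    "\<And>i. i \<le> k \<Longrightarrow> v i \<in> borel_measurable N"
  shows "st k \<in> borel_measurable N \<and> (\<forall>j. (\<lambda>\<omega>. est k \<omega> j) \<in> borel_measurable N)"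
  using assms
proof (induction k)
  case 0
  then have [measurable]: "x0 \<in> borel_measurable N" "v 0 \<in> borel_measurable N" by auto
  have "inn 0 \<in> borel_measurable N" unfolding innov_def by simp
  then have "(\<lambda>\<omega>. est 0 \<omega> j) \<in> borel_measurable N" for j
    unfolding est_0 by (cases "j = 1") simp_all
  then show ?case by (simp add: st_0)
next
  case (Suc k)
  have [measurable]: "st k \<in> borel_measurable N" "\<And>j. (\<lambda>\<omega>. est k \<omega> j) \<in> borel_measurable N"
     "w k \<in> borel_measurable N" "v (Suc k) \<in> borel_measurable N"
    using Suc by auto
  have [measurable]: "ctl k \<in> borel_measurable N" unfolding ctl_def by measurable
  have [measurable]: "st (Suc k) \<in> borel_measurable N" unfolding st_Suc by measurable
  show ?case unfolding est_Suc Let_def by (intro conjI allI) measurable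
qed

lemma wf_cov: "psd (sP0 s)" "psd (sW s)" "pd (sV s)" "psd (sV s)"
  using wf pd_imp_psd by (auto simp: lqg_wf_def)

lemma noise_gauss: "char_gauss M x0 (sP0 s)" "char_gauss M (w k) (sW s)" "char_gauss M (v k) (sV s)"
  using noise wf_cov by (auto simp: lqg_noise_def intro: gaussian_vec_char_gauss)

lemma noise_square_integrable:
  "square_integrable M x0" "square_integrable M (w k)" "square_integrable M (v k)"
  using noise wf_cov by (auto simp: lqg_noise_def intro: gaussian_vec_square_integrable)

lemma square_integrable_errs: "square_integrable M (perr k)"
  by (induction k) (auto intro!: square_integrable_intros noise_square_integrable)

lemma square_integrable_inn: "square_integrable M (inn k)"
  unfolding innov_def by (intro square_integrable_intros square_integrable_errs noise_square_integrable)

lemma square_integrable_ferr: "square_integrable M (ferr k)"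
  unfolding filter_err_def by (intro square_integrable_intros square_integrable_errs square_integrable_inn)

lemma square_integrable_loop: "square_integrable M (st k) \<and> (\<forall>j. square_integrable M (\<lambda>\<omega>. est k \<omega> j))"
proof (induction k)
  case 0
  have "square_integrable M (\<lambda>\<omega>. est 0 \<omega> j)" for j
    unfolding est_0 by (cases "j = 1") (simp_all add: square_integrable_inn square_integrable_zero)
  then show ?case using noise_square_integrable(1) by (simp add: st_0)
next
  case (Suc k)
  note IH = conjunct1[OF Suc] conjunct2[OF Suc, rule_format]
  have c: "square_integrable M (ctl k)" unfolding ctl_def by (intro square_integrable_intros IH)
  have st: "square_integrable M (st (Suc k))"
    unfolding st_Suc by (intro square_integrable_intros IH c noise_square_integrable)
  have [measurable]: "(\<lambda>\<omega>. est k \<omega> j) \<in> borel_measurable M" for j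
    using IH by (simp add: square_integrable_def)
  have "square_integrable M (\<lambda>\<omega>. est (Suc k) \<omega> j)" for j
    unfolding est_Suc Let_def
    by (cases "j = 1") (simp_all, (intro square_integrable_intros IH c st noise_square_integrable, (measurable)?)+)
  then show ?case using st by blast
qed

lemma square_integrable_mis: "square_integrable M (\<lambda>\<omega>. mis k \<omega> j)"
  unfolding mis_def using square_integrable_loop by (intro square_integrable_intros) auto

end

section \<open>Independence and sign symmetry of the errors\<close>

lemma Int_stable_preimages: "Int_stable {X -` A \<inter> S | A. A \<in> sets N}"
proof (rule Int_stableI)
  fix a b assume "a \<in> {X -` A \<inter> S | A. A \<in> sets N}" "b \<in> {X -` A \<inter> S | A. A \<in> sets N}"
  then obtain A B where "A \<in> sets N" "B \<in> sets N" "a = X -` A \<inter> S" "b = X -` B \<inter> S" by auto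
  then show "a \<inter> b \<in> {X -` A \<inter> S | A. A \<in> sets N}"
    by (intro CollectI exI[of _ "A \<inter> B"]) auto
qed

lemma borel_measurable_embed_first:
  "(\<lambda>\<zeta> j. if j = 0 then \<zeta> else 0) \<in> measurable (borel :: (real^'n) measure) (borel :: (nat \<Rightarrow> real^'n) measure)"
proof (rule measurable_coordinatewise_then_product)
  show "(\<lambda>\<zeta>. if j = 0 then \<zeta> else 0) \<in> borel_measurable (borel :: (real^'n) measure)" for j :: nat
    by (cases "j = 0") auto
qed

context even_scheduling
begin

definition hist :: "noise_idx set \<Rightarrow> 'a measure" where
  "hist J = sigma (space M) (\<Union>i\<in>J. noise_family M x0 w v i)"

lemma noise_family_subset: "noise_family M x0 w v i \<subseteq> Pow (space M)"
  by (auto simp: noise_family_def split: noise_idx.splits)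

lemma Int_stable_noise_family: "Int_stable (noise_family M x0 w v i)"
  by (cases i) (simp_all add: noise_family_def Int_stable_preimages)

lemma hist_measurable:
  assumes "i \<in> J" and "\<And>A. A \<in> sets borel \<Longrightarrow> X -` A \<inter> space M \<in> noise_family M x0 w v i"
  shows "X \<in> borel_measurable (hist J)"
proof (rule measurableI)
  have sub: "(\<Union>i\<in>J. noise_family M x0 w v i) \<subseteq> Pow (space M)" using noise_family_subset by blast
  fix A :: "'b set" assume "A \<in> sets borel"
  then have "X -` A \<inter> space M \<in> (\<Union>i\<in>J. noise_family M x0 w v i)" using assms by blast
  then show "X -` A \<inter> space (hist J) \<in> sets (hist J)"
    using sub by (simp add: hist_def space_measure_of_conv sets_measure_of)
qed simp

lemma hist_noise:
  "NX0 \<in> J \<Longrightarrow> x0 \<in> borel_measurable (hist J)"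
  "NW k \<in> J \<Longrightarrow> w k \<in> borel_measurable (hist J)"
  "NV k \<in> J \<Longrightarrow> v k \<in> borel_measurable (hist J)"
  by (rule hist_measurable, assumption, simp add: noise_family_def, blast)+

lemma noise_indep_pair:
  fixes X :: "'a \<Rightarrow> 'b::second_countable_topology"
  assumes "X \<in> borel_measurable (hist J)"
  shows "NW k \<notin> J \<Longrightarrow> indep_pair M (w k) X" "NV k \<notin> J \<Longrightarrow> indep_pair M (v k) X"
proof -
  have ind: "indep_sets (noise_family M x0 w v) UNIV" using noise by (simp add: lqg_noise_def)
  note I = indep_sets_indep_pair[OF ind Int_stable_noise_family _ _ assms[unfolded hist_def]]
  have "w k \<in> borel_measurable (hist {NW k})" "v k \<in> borel_measurable (hist {NV k})"
    by (auto intro: hist_noise)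
  then show "NW k \<notin> J \<Longrightarrow> indep_pair M (w k) X" "NV k \<notin> J \<Longrightarrow> indep_pair M (v k) X"
    by (auto simp: hist_def intro: I)
qed

text \<open>\<open>past k\<close> stops just before the measurement noise \<open>v k\<close>, and
  \<open>present k\<close> just before the process noise \<open>w k\<close>, so the next noise is
  independent of what has been generated.\<close>

definition "past k = {NX0} \<union> NW ` {..<k} \<union> NV ` {..<k}"
definition "present k = {NX0} \<union> NW ` {..<k} \<union> NV ` {..k}"

lemma perr_hist: "past k \<subseteq> J \<Longrightarrow> perr k \<in> borel_measurable (hist J)"
  by (rule borel_measurable_errs) (auto intro!: hist_noise simp: past_def image_subset_iff)

lemma ferr_hist:
  assumes "present k \<subseteq> J" shows "ferr k \<in> borel_measurable (hist J)"
proof -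
  have [measurable]: "perr k \<in> borel_measurable (hist J)" "v k \<in> borel_measurable (hist J)"
    using assms by (auto intro!: hist_noise perr_hist simp: past_def present_def image_subset_iff)
  show ?thesis unfolding filter_err_def innov_def by measurable
qed

lemma loop_hist:
  assumes "present k \<subseteq> J"
  shows "st k \<in> borel_measurable (hist J)" "(\<lambda>\<omega>. est k \<omega> j) \<in> borel_measurable (hist J)"
    "mis k \<in> borel_measurable (hist J)"
proof -
  have "st k \<in> borel_measurable (hist J) \<and> (\<forall>j. (\<lambda>\<omega>. est k \<omega> j) \<in> borel_measurable (hist J))"
    using assms by (intro borel_measurable_loop) (auto intro!: hist_noise simp: present_def image_subset_iff)
  then show "st k \<in> borel_measurable (hist J)" and e[measurable]: "(\<lambda>\<omega>. est k \<omega> j) \<in> borel_measurable (hist J)" for j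
    by auto
  show "mis k \<in> borel_measurable (hist J)"
    unfolding mis_def[abs_def] by (rule measurable_coordinatewise_then_product) measurable
qed

lemma kalman_update:
  assumes "char_gauss M (perr k) (Ppred s k)"
  shows "char_gauss M (ferr k) (Ppred s k - Kgain s k ** sC s ** Ppred s k)"
    "char_gauss M (inn k) (Kgain s k ** sC s ** Ppred s k)" "indep_pair M (ferr k) (inn k)"
proof -
  have "indep_pair M (v k) (perr k)"
    by (rule noise_indep_pair[OF perr_hist[OF order_refl]]) (auto simp: past_def)
  note K = kalman_measurement_update[OF assms noise_gauss(3) this wf_cov(3), of "sC s", folded Kgain.simps]
  show "char_gauss M (ferr k) (Ppred s k - Kgain s k ** sC s ** Ppred s k)"
    "char_gauss M (inn k) (Kgain s k ** sC s ** Ppred s k)" "indep_pair M (ferr k) (inn k)"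
    using K unfolding filter_err_def[abs_def] innov_def[abs_def] by simp_all
qed

lemma perr_gauss: "char_gauss M (perr k) (Ppred s k)"
proof (induction k)
  case 0
  then show ?case using noise_gauss by (simp add: Ppred.simps)
next
  case (Suc k)
  have "indep_pair M (w k) (ferr k)"
    by (rule noise_indep_pair[OF ferr_hist[OF order_refl]]) (auto simp: present_def)
  from char_gauss_linear_add[OF kalman_update(1)[OF Suc] noise_gauss(2) this, of "sA s"]
  show ?case unfolding pred_err_Suc Ppred.simps .
qed

lemmas ferr_gauss = kalman_update(1)[OF perr_gauss]
lemmas inn_gauss = kalman_update(2)[OF perr_gauss]
lemmas ferr_inn_indep = kalman_update(3)[OF perr_gauss]

text \<open>\<open>w k\<close> and then \<open>v (Suc k)\<close> are attached to the filtering
  error, keeping independence from \<open>mis k\<close>. The new filtering error and innovation are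
  functions of the result, and by the Kalman update they are independent of each other.\<close>

lemma ferr_mis_update:
  assumes "indep_pair M (ferr k) (mis k)"
  shows "indep_pair M (ferr (Suc k)) (\<lambda>\<omega>. (inn (Suc k) \<omega>, mis k \<omega>))" "indep_pair M (inn (Suc k)) (mis k)"
proof -
  have [measurable]: "ferr k \<in> borel_measurable (hist (present k))" "mis k \<in> borel_measurable (hist (present k))"
    by (auto intro: ferr_hist loop_hist)
  have "(\<lambda>\<omega>. (ferr k \<omega>, mis k \<omega>)) \<in> borel_measurable (hist (present k))"
    unfolding borel_prod[symmetric] by simp
  then have "indep_pair M (w k) (\<lambda>\<omega>. (ferr k \<omega>, mis k \<omega>))"
    by (rule noise_indep_pair) (auto simp: present_def)
  from indep_pair_join[OF assms this] have *: "indep_pair M (\<lambda>\<omega>. (ferr k \<omega>, w k \<omega>)) (mis k)" .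
  have "(\<lambda>p. sA s *v fst p + snd p) \<in> borel_measurable (borel :: ((real^'n) \<times> (real^'n)) measure)"
    unfolding borel_prod[symmetric] by measurable
  from indep_pair_compose[OF * this, of "\<lambda>z. z"] have pm: "indep_pair M (perr (Suc k)) (mis k)"
    unfolding pred_err_Suc by simp
  let ?J = "past (Suc k)"
  have [measurable]: "perr (Suc k) \<in> borel_measurable (hist ?J)" "mis k \<in> borel_measurable (hist ?J)"
    by (rule perr_hist[OF order_refl], rule loop_hist) (auto simp: past_def present_def)
  have "(\<lambda>\<omega>. (perr (Suc k) \<omega>, mis k \<omega>)) \<in> borel_measurable (hist ?J)"
    unfolding borel_prod[symmetric] by (simp del: pred_err.simps)
  then have "indep_pair M (v (Suc k)) (\<lambda>\<omega>. (perr (Suc k) \<omega>, mis k \<omega>))"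
    by (rule noise_indep_pair) (auto simp: past_def)
  from indep_pair_join[OF pm this]
  have **: "indep_pair M (\<lambda>\<omega>. (perr (Suc k) \<omega>, v (Suc k) \<omega>)) (mis k)" .
  let ?K = "Kgain s (Suc k)" and ?C = "sC s"
  have "(\<lambda>p. (fst p - ?K *v (?C *v fst p + snd p), ?K *v (?C *v fst p + snd p)))
      \<in> borel_measurable (borel :: ((real^'n) \<times> (real^'p)) measure)"
    unfolding borel_prod[symmetric] by measurable
  from indep_pair_compose[OF ** this, of "\<lambda>z. z"]
  have J: "indep_pair M (\<lambda>\<omega>. (ferr (Suc k) \<omega>, inn (Suc k) \<omega>)) (mis k)"
    by (simp add: filter_err_def innov_def del: pred_err.simps)
  show "indep_pair M (ferr (Suc k)) (\<lambda>\<omega>. (inn (Suc k) \<omega>, mis k \<omega>))"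
    by (rule indep_pair_regroup[OF ferr_inn_indep J])
  show "indep_pair M (inn (Suc k)) (mis k)"
    using indep_pair_compose[OF J, of snd "\<lambda>z. z"] by (simp add: borel_prod[symmetric])
qed

text \<open>The new mismatch errors are a function of the new innovation and the old mismatch
  errors, so decisions carry no information about the filtering error.\<close>

lemma ferr_mis_indep: "indep_pair M (ferr k) (mis k)"
proof (induction k)
  case 0
  from indep_pair_compose[OF ferr_inn_indep[of 0] _ borel_measurable_embed_first, of "\<lambda>x. x"]
  show ?case by (simp add: mis_0[abs_def])
next
  case (Suc k)
  from indep_pair_compose[OF ferr_mis_update(1)[OF Suc] _ borel_measurable_mismatch_step[where A="sA s" and D="D k", OF D_meas], of "\<lambda>x. x"]
  show ?case by (simp add: mis_Suc[abs_def])
qed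

lemmas inn_mis_indep = ferr_mis_update(2)[OF ferr_mis_indep]

lemma mis_measurable [measurable]: "mis k \<in> borel_measurable M" "inn k \<in> borel_measurable M" "ferr k \<in> borel_measurable M"
  using ferr_mis_indep[of k] inn_gauss[of k] by (auto dest: indep_pair_measurable simp: char_gauss_def)

text \<open>The prefix to be negated one step earlier depends on the random decision of scheduler
  \<open>Suc q\<close>. The law is therefore split by this decision into \<open>\<phi>1\<close> and
  \<open>\<phi>2\<close>, and the induction hypothesis is used with \<open>q\<close> on one part and
  \<open>Suc q\<close> on the other. Evenness keeps each part fixed under its flip.\<close>

lemma mis_flip: "distr M borel (mis k) = distr M borel (\<lambda>\<omega>. flip p (mis k \<omega>))"
proof (induction k arbitrary: p)
  case 0
  show ?case
  proof (cases p)
    case 0 then show ?thesis by (simp add: flip_0)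
  next
    case (Suc q)
    \<comment> \<open>At time \<open>0\<close> only the first coordinate is nonzero, so negating any
      nonempty prefix just negates the innovation.\<close>
    let ?f = "\<lambda>\<zeta> (j::nat). if j = 0 then \<zeta> else (0 :: real^'n)"
    have f: "?f \<in> borel_measurable borel"
      by (rule borel_measurable_embed_first)
    have "distr M borel (\<lambda>\<omega>. ?f (inn 0 \<omega>)) = distr (distr M borel (inn 0)) borel ?f"
      using f by (subst distr_distr) (auto simp: comp_def)
    also have "\<dots> = distr (distr M borel (\<lambda>\<omega>. - inn 0 \<omega>)) borel ?f"
      by (subst char_gauss_uminus[OF inn_gauss]) simp
    also have "\<dots> = distr M borel (\<lambda>\<omega>. ?f (- inn 0 \<omega>))"
      using f by (subst distr_distr) (auto simp: comp_def)
    also have "(\<lambda>\<omega>. ?f (- inn 0 \<omega>)) = (\<lambda>\<omega>. flip p (mis 0 \<omega>))"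
      by (intro ext) (simp add: Suc flip_def mis_0)
    finally show ?thesis by (simp add: mis_0[abs_def])
  qed
next
  case (Suc k)
  show ?case
  proof (cases p)
    case 0 then show ?thesis by (simp add: flip_0)
  next
    case p: (Suc q)
    let ?H = "mismatch_step (sA s) (D k)"
    have Hm: "(\<lambda>p. ?H (fst p) (snd p)) \<in> borel_measurable borel"
      by (rule borel_measurable_mismatch_step[OF D_meas])
    have pm: "(\<lambda>\<omega>. (inn (Suc k) \<omega>, mis k \<omega>)) \<in> borel_measurable M"
      unfolding borel_prod[symmetric] by simp
    have fm: "(\<lambda>\<omega>. (- inn (Suc k) \<omega>, flip r (mis k \<omega>))) \<in> borel_measurable M" for r
      unfolding borel_prod[symmetric] using measurable_compose[OF mis_measurable(1) borel_measurable_flip] by simp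
    \<comment> \<open>By independence the innovation may be negated together with any prefix
      \<open>r\<close> of the old mismatch errors.\<close>
    have law: "(\<integral>\<^sup>+\<omega>. \<phi> (inn (Suc k) \<omega>, mis k \<omega>) \<partial>M) = (\<integral>\<^sup>+\<omega>. \<phi> (- inn (Suc k) \<omega>, flip r (mis k \<omega>)) \<partial>M)"
      if \<phi>: "\<phi> \<in> borel_measurable borel" for \<phi> :: "(real^'n) \<times> (nat \<Rightarrow> real^'n) \<Rightarrow> ennreal" and r
    proof -
      have "distr M borel (\<lambda>\<omega>. (inn (Suc k) \<omega>, mis k \<omega>)) = distr M borel (\<lambda>\<omega>. (- inn (Suc k) \<omega>, flip r (mis k \<omega>)))"
        by (rule indep_pair_distr_eq[OF inn_mis_indep _ borel_measurable_flip char_gauss_uminus[OF inn_gauss] Suc.IH]) simp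
      then show ?thesis using nn_integral_distr[OF pm, of \<phi>] nn_integral_distr[OF fm, of \<phi> r] \<phi> by simp
    qed
    have mS: "mis (Suc k) = (\<lambda>\<omega>. ?H (inn (Suc k) \<omega>) (mis k \<omega>))" by (rule ext) (rule mis_Suc)
    show ?thesis
    proof (rule measure_eqI)
      fix A assume "A \<in> sets (distr M borel (mis (Suc k)))"
      then have A[measurable]: "A \<in> sets borel" by simp
      let ?i = "indicator A :: _ \<Rightarrow> ennreal"
      have em: "emeasure (distr M borel X) A = (\<integral>\<^sup>+\<omega>. ?i (X \<omega>) \<partial>M)" if "X \<in> borel_measurable M" for X
        using nn_integral_distr[OF that, of ?i] by simp
      define \<phi>1 where "\<phi>1 x = (if D k (Suc q) (snd x q) then ?i (?H (fst x) (snd x)) else 0)" for x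
      define \<phi>2 where "\<phi>2 x = (if D k (Suc q) (snd x q) then 0 else ?i (?H (fst x) (snd x)))" for x
      have [measurable]: "(\<lambda>x. ?i (?H (fst x) (snd x))) \<in> borel_measurable (borel \<Otimes>\<^sub>M borel)"
        unfolding borel_prod by (rule measurable_compose[OF Hm]) simp
      have [measurable]: "(\<lambda>p::(real^'n) \<times> (nat \<Rightarrow> real^'n). snd p q) \<in> borel_measurable (borel \<Otimes>\<^sub>M borel)"
        by (rule measurable_compose[OF measurable_snd measurable_product_coordinates])
      have \<phi>m: "\<phi>1 \<in> borel_measurable borel" "\<phi>2 \<in> borel_measurable borel"
        unfolding \<phi>1_def[abs_def] \<phi>2_def[abs_def] borel_prod[symmetric] by measurable
      have "emeasure (distr M borel (\<lambda>\<omega>. flip p (mis (Suc k) \<omega>))) A = (\<integral>\<^sup>+\<omega>. ?i (flip p (mis (Suc k) \<omega>)) \<partial>M)"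
        by (rule em, rule measurable_compose[OF mis_measurable(1) borel_measurable_flip])
      also have "\<dots> = (\<integral>\<^sup>+\<omega>. \<phi>1 (- inn (Suc k) \<omega>, flip q (mis k \<omega>)) + \<phi>2 (- inn (Suc k) \<omega>, flip (Suc q) (mis k \<omega>)) \<partial>M)"
      proof (rule nn_integral_cong)
        fix \<omega>
        have "D k (Suc q) (flip q (mis k \<omega>) q) = D k (Suc q) (mis k \<omega> q)"
          "D k (Suc q) (flip (Suc q) (mis k \<omega>) q) = D k (Suc q) (mis k \<omega> q)"
          by (simp_all add: flip_def D_even)
        then show "?i (flip p (mis (Suc k) \<omega>)) = \<phi>1 (- inn (Suc k) \<omega>, flip q (mis k \<omega>)) + \<phi>2 (- inn (Suc k) \<omega>, flip (Suc q) (mis k \<omega>))"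
          unfolding p mis_Suc flip_mismatch_step[of "D k", OF D_even] \<phi>1_def \<phi>2_def by simp
      qed
      also have "\<dots> = (\<integral>\<^sup>+\<omega>. \<phi>1 (inn (Suc k) \<omega>, mis k \<omega>) \<partial>M) + (\<integral>\<^sup>+\<omega>. \<phi>2 (inn (Suc k) \<omega>, mis k \<omega>) \<partial>M)"
        unfolding law[OF \<phi>m(1), of q] law[OF \<phi>m(2), of "Suc q"]
        by (rule nn_integral_add) (rule measurable_compose[OF fm \<phi>m(1)], rule measurable_compose[OF fm \<phi>m(2)])
      also have "\<dots> = (\<integral>\<^sup>+\<omega>. \<phi>1 (inn (Suc k) \<omega>, mis k \<omega>) + \<phi>2 (inn (Suc k) \<omega>, mis k \<omega>) \<partial>M)"
        by (rule nn_integral_add[symmetric]) (rule measurable_compose[OF pm \<phi>m(1)], rule measurable_compose[OF pm \<phi>m(2)])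
      also have "\<dots> = (\<integral>\<^sup>+\<omega>. ?i (mis (Suc k) \<omega>) \<partial>M)"
        unfolding mis_Suc \<phi>1_def \<phi>2_def by (intro nn_integral_cong) simp
      also have "\<dots> = emeasure (distr M borel (mis (Suc k))) A"
        by (rule em[symmetric]) simp
      finally show "emeasure (distr M borel (mis (Suc k))) A = emeasure (distr M borel (\<lambda>\<omega>. flip p (mis (Suc k) \<omega>))) A" ..
    qed simp
  qed
qed

lemma mis_odd_integral_zero:
  fixes f :: "(nat \<Rightarrow> real^'n) \<Rightarrow> real"
  assumes f: "f \<in> borel_measurable borel" and odd: "\<And>z. f (flip p z) = - f z"
  shows "(\<integral>\<omega>. f (mis k \<omega>) \<partial>M) = 0"
proof -
  have "(\<integral>\<omega>. f (mis k \<omega>) \<partial>M) = (\<integral>\<omega>. f (flip p (mis k \<omega>)) \<partial>M)"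
    by (rule integral_distr_eq[OF mis_flip _ _ f])
       (use measurable_compose[OF mis_measurable(1) borel_measurable_flip] in auto)
  then show ?thesis by (simp add: odd)
qed

end

section \<open>Cost decomposition\<close>

lemma sum_shift_telescope:
  fixes f :: "nat \<Rightarrow> real"
  shows "(\<Sum>i<n. f (Suc i)) + f 0 = (\<Sum>i<n. f i) + f n"
  by (induction n) simp_all

text \<open>\<open>a\<close> stands for withheld errors, \<open>b\<close> for transmitted ones,
  \<open>c\<close> for the new innovation. A transmitted error moves to the next row, one entry
  shorter, and stays inside the triangle. A withheld one keeps its row while its index advances,
  which leaves the overshoot \<open>a j (n - j)\<close>.\<close>

lemma triangular_sum_step:
  fixes a b :: "nat \<Rightarrow> nat \<Rightarrow> real" and c :: "nat \<Rightarrow> real"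
  shows "(\<Sum>j<n. \<Sum>i<n - j. a j (Suc i) + (case j of 0 \<Rightarrow> c i | Suc l \<Rightarrow> b l (Suc i))) + (\<Sum>j<n. a j 0 + b j 0)
    = (\<Sum>j<n. \<Sum>i<n - j. a j i + b j i) + (\<Sum>i<n. c i) + (\<Sum>j<n. a j (n - j))"
proof -
  have A: "(\<Sum>j<n. \<Sum>i<n - j. a j (Suc i)) + (\<Sum>j<n. a j 0) = (\<Sum>j<n. \<Sum>i<n - j. a j i) + (\<Sum>j<n. a j (n - j))"
    by (simp only: sum.distrib[symmetric] sum_shift_telescope)
  have B: "(\<Sum>j<n. \<Sum>i<n - j. (case j of 0 \<Rightarrow> c i | Suc l \<Rightarrow> b l (Suc i))) + (\<Sum>j<n. b j 0)
      = (\<Sum>i<n. c i) + (\<Sum>j<n. \<Sum>i<n - j. b j i)"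
  proof (cases n)
    case (Suc m)
    have "(\<Sum>i<m - j. b j (Suc i)) + b j 0 = (\<Sum>i<Suc m - j. b j i)" if "j < Suc m" for j
      using that by (simp add: Suc_diff_le sum.lessThan_Suc_shift del: sum.lessThan_Suc)
    then have "(\<Sum>j<Suc m. (\<Sum>i<m - j. b j (Suc i)) + b j 0) = (\<Sum>j<Suc m. \<Sum>i<Suc m - j. b j i)"
      by (intro sum.cong) auto
    then show ?thesis
      unfolding Suc by (subst sum.lessThan_Suc_shift) (simp add: sum.distrib)
  qed simp
  show ?thesis using A B by (simp add: sum.distrib)
qed

text \<open>Cost at time \<open>k\<close> of an error that was \<open>y\<close> at time
  \<open>k - i\<close> and has since only been propagated by \<open>sA s\<close>.\<close>

definition Gam_form :: "('n::finite,'m::finite,'p::finite) lqg \<Rightarrow> nat \<Rightarrow> nat \<Rightarrow> nat \<Rightarrow> real^'n \<Rightarrow> real" where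
  "Gam_form s T k i y = (mpow (sA s) i *v y) \<bullet> (Gam s T k *v (mpow (sA s) i *v y))"

text \<open>The fourth summand is the initial mismatch cost under permanent transmission, when only
  the first coordinate is nonzero. The fifth is what each later innovation would cost under
  permanent transmission.\<close>

definition sched_free_cost where
  "sched_free_cost M s T L x0 w v =
     (\<integral>\<omega>. x0 \<omega> \<bullet> (Sric s T 0 *v x0 \<omega>) \<partial>M)
     + (\<Sum>k<T. (\<integral>\<omega>. w k \<omega> \<bullet> (Sric s T (Suc k) *v w k \<omega>) \<partial>M))
     + (\<Sum>k<T. (\<integral>\<omega>. Gam_form s T k 0 (filter_err s x0 w v k \<omega>) \<partial>M))
     + (\<Sum>j<L. \<Sum>i<L - j. (\<integral>\<omega>. Gam_form s T i i (if j = 0 then innov s x0 w v 0 \<omega> else 0) \<partial>M))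
     + (\<Sum>k<T. \<Sum>i<L. (\<integral>\<omega>. Gam_form s T (Suc k + i) i (innov s x0 w v (Suc k) \<omega>) \<partial>M))"

lemma Gam_form_zero [simp]: "Gam_form s T k i 0 = 0"
  by (simp add: Gam_form_def)

lemma Gam_form_ge_T: "T \<le> k \<Longrightarrow> Gam_form s T k i y = 0"
  by (simp add: Gam_form_def Gam_def)

lemma Gam_form_mult: "Gam_form s T k i (sA s *v y) = Gam_form s T k (Suc i) y"
  unfolding Gam_form_def mpow_Suc_right by (simp add: matrix_vector_mul_assoc)

lemma Gam_form_add:
  assumes "lqg_wf s"
  shows "Gam_form s T k i (x + y) = Gam_form s T k i x
    + 2 * ((mpow (sA s) i *v x) \<bullet> (Gam s T k *v (mpow (sA s) i *v y))) + Gam_form s T k i y"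
  unfolding Gam_form_def matrix_vector_right_distrib[of "mpow (sA s) i"]
  by (rule quadratic_add) (use psd_Gam[OF assms] in \<open>simp add: psd_def\<close>)

lemma borel_measurable_Gam_form [measurable (raw)]:
  "f \<in> borel_measurable N \<Longrightarrow> (\<lambda>\<omega>. Gam_form s T k i (f \<omega>)) \<in> borel_measurable N"
  unfolding Gam_form_def by (intro borel_measurable_inner borel_measurable_matrix_vector_mult)

lemma integrable_Gam_form:
  "square_integrable M X \<Longrightarrow> integrable M (\<lambda>\<omega>. Gam_form s T k i (X \<omega>))"
  unfolding Gam_form_def by (intro square_integrable_quadratic square_integrable_intros)

context even_scheduling
begin

lemma integral_Gam_form_add:
  assumes X: "square_integrable M X" and Y: "square_integrable M Y"
    and cross: "(\<integral>\<omega>. (mpow (sA s) i *v X \<omega>) \<bullet> (Gam s T k *v (mpow (sA s) i *v Y \<omega>)) \<partial>M) = 0"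
  shows "(\<integral>\<omega>. Gam_form s T k i (X \<omega> + Y \<omega>) \<partial>M)
    = (\<integral>\<omega>. Gam_form s T k i (X \<omega>) \<partial>M) + (\<integral>\<omega>. Gam_form s T k i (Y \<omega>) \<partial>M)"
proof -
  have "integrable M (\<lambda>\<omega>. (mpow (sA s) i *v X \<omega>) \<bullet> (Gam s T k *v (mpow (sA s) i *v Y \<omega>)))"
    using X Y by (intro square_integrable_quadratic square_integrable_intros)
  then show ?thesis
    unfolding Gam_form_add[OF wf] using integrable_Gam_form[OF X, of s T k i] integrable_Gam_form[OF Y, of s T k i] cross by simp
qed

lemma stage_decomp:
  "(\<integral>\<omega>. Gam_form s T k 0 (st k \<omega> - est k \<omega> (L + 1)) \<partial>M)
    = (\<integral>\<omega>. Gam_form s T k 0 (ferr k \<omega>) \<partial>M) + (\<Sum>j<L. (\<integral>\<omega>. Gam_form s T k 0 (mis k \<omega> j) \<partial>M))"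
proof -
  have e: "st k \<omega> - est k \<omega> (L + 1) = ferr k \<omega> + (\<Sum>j<L. mis k \<omega> j)" for \<omega>
    unfolding st_est[symmetric] est_diff[symmetric] by simp
  have sum: "(\<integral>\<omega>. Gam_form s T k 0 (\<Sum>j<n. mis k \<omega> j) \<partial>M) = (\<Sum>j<n. (\<integral>\<omega>. Gam_form s T k 0 (mis k \<omega> j) \<partial>M))" for n
  proof (induction n)
    case (Suc n)
    have "(\<integral>\<omega>. (\<lambda>z. (mpow (sA s) 0 *v (\<Sum>j<n. z j)) \<bullet> (Gam s T k *v (mpow (sA s) 0 *v z n))) (mis k \<omega>) \<partial>M) = 0"
    \<comment> \<open>\<open>flip n\<close> negates the partial sum and fixes the next
      summand.\<close>
    proof (rule mis_odd_integral_zero[where p=n])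
      show "(\<lambda>z. (mpow (sA s) 0 *v (\<Sum>j<n. z j)) \<bullet> (Gam s T k *v (mpow (sA s) 0 *v z n)))
          \<in> borel_measurable (borel :: (nat \<Rightarrow> real^'n) measure)"
        by measurable
      fix z :: "nat \<Rightarrow> real^'n"
      have "(\<Sum>j<n. flip n z j) = - (\<Sum>j<n. z j)" by (simp add: flip_def sum_negf)
      then show "(mpow (sA s) 0 *v (\<Sum>j<n. flip n z j)) \<bullet> (Gam s T k *v (mpow (sA s) 0 *v flip n z n))
        = - ((mpow (sA s) 0 *v (\<Sum>j<n. z j)) \<bullet> (Gam s T k *v (mpow (sA s) 0 *v z n)))"
        by (simp add: flip_def matrix_vector_mult_uminus)
    qed
    from integral_Gam_form_add[OF _ _ this] Suc square_integrable_mis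
    show ?case by (simp add: square_integrable_sum)
  qed simp
  let ?f = "\<lambda>p :: (real^'n) \<times> (nat \<Rightarrow> real^'n).
    (mpow (sA s) 0 *v fst p) \<bullet> (Gam s T k *v (mpow (sA s) 0 *v (\<Sum>j<L. snd p j)))"
  have "(\<integral>\<omega>. ?f (ferr k \<omega>, mis k \<omega>) \<partial>M) = 0"
  proof (rule indep_pair_odd_integral_zero[OF ferr_mis_indep char_gauss_uminus[OF ferr_gauss]])
    have [measurable]: "(\<lambda>p::(real^'n) \<times> (nat \<Rightarrow> real^'n). snd p i) \<in> borel_measurable (borel \<Otimes>\<^sub>M borel)" for i
      by (rule measurable_compose[OF measurable_snd measurable_product_coordinates])
    show "?f \<in> borel_measurable borel" unfolding borel_prod[symmetric] by measurable
  qed (simp add: matrix_vector_mult_uminus)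
  then have "(\<integral>\<omega>. (mpow (sA s) 0 *v ferr k \<omega>) \<bullet> (Gam s T k *v (mpow (sA s) 0 *v (\<Sum>j<L. mis k \<omega> j))) \<partial>M) = 0"
    by simp
  from integral_Gam_form_add[OF square_integrable_ferr square_integrable_sum[OF square_integrable_mis] this]
  show ?thesis unfolding e sum .
qed

section \<open>Mismatch cost relative to permanent transmission\<close>

definition "kept k j m i = (\<integral>\<omega>. (if D k (Suc j) (mis k \<omega> j) then 0 else Gam_form s T m i (mis k \<omega> j)) \<partial>M)"
definition "sent k j m i = (\<integral>\<omega>. (if D k (Suc j) (mis k \<omega> j) then Gam_form s T m i (mis k \<omega> j) else 0) \<partial>M)"

lemma mis_coord_measurable [measurable]: "(\<lambda>\<omega>. mis k \<omega> j) \<in> borel_measurable M"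
  using square_integrable_mis by (simp add: square_integrable_def)

lemma integrable_kept_sent:
  "integrable M (\<lambda>\<omega>. if D k (Suc j) (mis k \<omega> j) then c else Gam_form s T m i (mis k \<omega> j))"
  "integrable M (\<lambda>\<omega>. if D k (Suc j) (mis k \<omega> j) then Gam_form s T m i (mis k \<omega> j) else c)"
proof -
  have b: "integrable M (\<lambda>\<omega>. \<bar>c\<bar> + \<bar>Gam_form s T m i (mis k \<omega> j)\<bar>)"
    by (intro Bochner_Integration.integrable_add integrable_abs integrable_Gam_form square_integrable_mis) simp
  have [measurable]: "Measurable.pred M (\<lambda>\<omega>. D k (Suc j) (mis k \<omega> j))"
    by (rule measurable_compose[OF mis_coord_measurable D_meas])
  have [measurable]: "(\<lambda>\<omega>. Gam_form s T m i (mis k \<omega> j)) \<in> borel_measurable M"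
    by (rule borel_measurable_Gam_form[OF mis_coord_measurable])
  show "integrable M (\<lambda>\<omega>. if D k (Suc j) (mis k \<omega> j) then c else Gam_form s T m i (mis k \<omega> j))"
    "integrable M (\<lambda>\<omega>. if D k (Suc j) (mis k \<omega> j) then Gam_form s T m i (mis k \<omega> j) else c)"
    by (rule Bochner_Integration.integrable_bound[OF b], simp, force)+
qed

lemma kept_sent: "kept k j m i + sent k j m i = (\<integral>\<omega>. Gam_form s T m i (mis k \<omega> j) \<partial>M)"
  unfolding kept_def sent_def
  by (subst Bochner_Integration.integral_add[symmetric])
     (auto intro!: integrable_kept_sent Bochner_Integration.integral_cong)

text \<open>Each new coordinate has two sources, whose cross term is odd. In coordinate
  \<open>0\<close> the symmetric innovation is independent of the old error; otherwise negating the
  first \<open>Suc l\<close> coordinates reverses the transmitted source but not the withheld one,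
  and changes neither decision.\<close>

lemma mis_step_form:
  "(\<integral>\<omega>. Gam_form s T m i (mis (Suc k) \<omega> j) \<partial>M) = kept k j m (Suc i)
     + (case j of 0 \<Rightarrow> (\<integral>\<omega>. Gam_form s T m i (inn (Suc k) \<omega>) \<partial>M) | Suc l \<Rightarrow> sent k l m (Suc i))"
proof -
  let ?A = "sA s" and ?P = "mpow (sA s) i"
  have siA: "square_integrable M (\<lambda>\<omega>. if D k (Suc l) (mis k \<omega> l) then ?A *v mis k \<omega> l else 0)"
    "square_integrable M (\<lambda>\<omega>. if D k (Suc l) (mis k \<omega> l) then 0 else ?A *v mis k \<omega> l)" for l
    by (intro square_integrable_intros square_integrable_mis, measurable)+
  have kept: "(\<integral>\<omega>. Gam_form s T m i (if D k (Suc j) (mis k \<omega> j) then 0 else ?A *v mis k \<omega> j) \<partial>M) = kept k j m (Suc i)"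
    unfolding kept_def by (intro Bochner_Integration.integral_cong) (auto simp: Gam_form_mult)
  show ?thesis
  proof (cases j)
    case 0
    let ?f = "\<lambda>p :: (real^'n) \<times> (nat \<Rightarrow> real^'n).
      (?P *v (if D k (Suc 0) (snd p 0) then 0 else ?A *v snd p 0)) \<bullet> (Gam s T m *v (?P *v fst p))"
    have "(\<integral>\<omega>. ?f (inn (Suc k) \<omega>, mis k \<omega>) \<partial>M) = 0"
    proof (rule indep_pair_odd_integral_zero[OF inn_mis_indep char_gauss_uminus[OF inn_gauss]])
      have [measurable]: "(\<lambda>p::(real^'n) \<times> (nat \<Rightarrow> real^'n). snd p i) \<in> borel_measurable (borel \<Otimes>\<^sub>M borel)" for i
        by (rule measurable_compose[OF measurable_snd measurable_product_coordinates])
      show "?f \<in> borel_measurable borel" unfolding borel_prod[symmetric] by measurable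
    qed (simp add: matrix_vector_mult_uminus)
    then have "(\<integral>\<omega>. (?P *v (if D k (Suc 0) (mis k \<omega> 0) then 0 else ?A *v mis k \<omega> 0))
        \<bullet> (Gam s T m *v (?P *v inn (Suc k) \<omega>)) \<partial>M) = 0" by (simp cong: if_cong)
    from integral_Gam_form_add[OF siA(2) square_integrable_inn this]
    show ?thesis using kept[unfolded 0] by (simp add: 0 mis_Suc mismatch_step_def)
  next
    case (Suc l)
    let ?f = "\<lambda>z :: nat \<Rightarrow> real^'n. (?P *v (if D k (Suc l) (z l) then ?A *v z l else 0))
      \<bullet> (Gam s T m *v (?P *v (if D k (Suc (Suc l)) (z (Suc l)) then 0 else ?A *v z (Suc l))))"
    have "(\<integral>\<omega>. ?f (mis k \<omega>) \<partial>M) = 0"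
    proof (rule mis_odd_integral_zero[where p="Suc l"])
      show "?f \<in> borel_measurable borel" by measurable
    qed (simp add: flip_def matrix_vector_mult_uminus D_even)
    from integral_Gam_form_add[OF siA(1) siA(2) this]
    have "(\<integral>\<omega>. Gam_form s T m i (mis (Suc k) \<omega> j) \<partial>M)
      = (\<integral>\<omega>. Gam_form s T m i (if D k (Suc l) (mis k \<omega> l) then ?A *v mis k \<omega> l else 0) \<partial>M) + kept k j m (Suc i)"
      using kept[unfolded Suc] by (simp add: Suc mis_Suc mismatch_step_def)
    also have "(\<integral>\<omega>. Gam_form s T m i (if D k (Suc l) (mis k \<omega> l) then ?A *v mis k \<omega> l else 0) \<partial>M) = sent k l m (Suc i)"
      unfolding sent_def by (intro Bochner_Integration.integral_cong) (auto simp: Gam_form_mult)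
    finally show ?thesis by (simp add: Suc)
  qed
qed

text \<open>The cost the current mismatch errors still cause if from time \<open>k\<close> on every scheduler transmits
  at every step.\<close>

definition "potential k = (\<Sum>j<L. \<Sum>i<L - j. (\<integral>\<omega>. Gam_form s T (k + i) i (mis k \<omega> j) \<partial>M))"

text \<open>Under permanent transmission the error in coordinate \<open>j\<close> at time
  \<open>k\<close> is in coordinate \<open>j + i\<close> at time \<open>k + i\<close>, hence the
  range \<open>i < L - j\<close>. Withholding overshoots that range by one, which is the last
  sum.\<close>

lemma potential_step:
  "potential (Suc k) + (\<Sum>j<L. (\<integral>\<omega>. Gam_form s T k 0 (mis k \<omega> j) \<partial>M))
   = potential k + (\<Sum>i<L. (\<integral>\<omega>. Gam_form s T (Suc k + i) i (inn (Suc k) \<omega>) \<partial>M))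
     + (\<Sum>j<L. kept k j (k + (L - j)) (L - j))"
  using triangular_sum_step[where n=L and a="\<lambda>j i. kept k j (k + i) i" and b="\<lambda>j i. sent k j (k + i) i"
      and c="\<lambda>i. \<integral>\<omega>. Gam_form s T (Suc k + i) i (inn (Suc k) \<omega>) \<partial>M"]
  unfolding potential_def mis_step_form add_Suc_shift kept_sent add_0_right .

lemma potential_T: "potential T = 0"
  by (simp add: potential_def Gam_form_ge_T)

text \<open>The steps telescope, and nothing remains at the horizon because \<open>Gam\<close> is
  zero from time \<open>T\<close> on.\<close>

lemma mismatch_cost:
  "(\<Sum>k<T. \<Sum>j<L. (\<integral>\<omega>. Gam_form s T k 0 (mis k \<omega> j) \<partial>M))
   = potential 0 + (\<Sum>k<T. \<Sum>i<L. (\<integral>\<omega>. Gam_form s T (Suc k + i) i (inn (Suc k) \<omega>) \<partial>M))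
     + (\<Sum>k<T. \<Sum>j<L. kept k j (k + (L - j)) (L - j))"
proof -
  have "potential n + (\<Sum>k<n. \<Sum>j<L. (\<integral>\<omega>. Gam_form s T k 0 (mis k \<omega> j) \<partial>M))
   = potential 0 + (\<Sum>k<n. \<Sum>i<L. (\<integral>\<omega>. Gam_form s T (Suc k + i) i (inn (Suc k) \<omega>) \<partial>M))
     + (\<Sum>k<n. \<Sum>j<L. kept k j (k + (L - j)) (L - j))" for n
  proof (induction n)
    case (Suc n)
    then show ?case using potential_step[of n] by simp
  qed simp
  from this[of T] show ?thesis by (simp add: potential_T)
qed

section \<open>Control cost as a sum of estimation error costs\<close>

lemma control_cost_step:
  assumes k: "k < T"
  shows "(\<integral>\<omega>. st k \<omega> \<bullet> (sQ s *v st k \<omega>) + ctl k \<omega> \<bullet> (sR s *v ctl k \<omega>) \<partial>M)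
      + (\<integral>\<omega>. st (Suc k) \<omega> \<bullet> (Sric s T (Suc k) *v st (Suc k) \<omega>) \<partial>M)
    = (\<integral>\<omega>. st k \<omega> \<bullet> (Sric s T k *v st k \<omega>) \<partial>M) + (\<integral>\<omega>. w k \<omega> \<bullet> (Sric s T (Suc k) *v w k \<omega>) \<partial>M)
      + (\<integral>\<omega>. Gam_form s T k 0 (st k \<omega> - est k \<omega> (L + 1)) \<partial>M)"
proof -
  let ?S = "Sric s T (Suc k)"
  define y where "y \<omega> = sA s *v st k \<omega> + sB s *v ctl k \<omega>" for \<omega>
  have Ss: "transpose ?S = ?S" using psd_Sback[OF wf] by (simp add: Sric_def psd_def)
  have si: "square_integrable M (st k)" "square_integrable M (\<lambda>\<omega>. est k \<omega> j)" for j
    using square_integrable_loop by auto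
  have sc: "square_integrable M (ctl k)" unfolding ctl_def by (intro square_integrable_intros si)
  have sy: "square_integrable M y" unfolding y_def by (intro square_integrable_intros si sc)
  have sw: "square_integrable M (w k)" by (rule noise_square_integrable)
  have "y \<in> borel_measurable (hist (present k))"
  proof -
    have [measurable]: "st k \<in> borel_measurable (hist (present k))"
      "(\<lambda>\<omega>. est k \<omega> j) \<in> borel_measurable (hist (present k))" for j
      by (rule loop_hist[OF order_refl])+
    show ?thesis unfolding y_def ctl_def by measurable
  qed
  then have ind: "indep_pair M (w k) y"
    by (rule noise_indep_pair) (auto simp: present_def)
  \<comment> \<open>\<open>y\<close> is generated by noises that do not include \<open>w k\<close>,
    and the cross term is linear in \<open>w k\<close>.\<close>
  have "(\<integral>\<omega>. (\<lambda>p. snd p \<bullet> (?S *v fst p)) (w k \<omega>, y \<omega>) \<partial>M) = 0"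
  proof (rule indep_pair_odd_integral_zero[OF ind char_gauss_uminus[OF noise_gauss(2)]])
    show "(\<lambda>p. snd p \<bullet> (?S *v fst p)) \<in> borel_measurable (borel :: ((real^'n) \<times> (real^'n)) measure)"
      unfolding borel_prod[symmetric] by measurable
  qed (simp add: matrix_vector_mult_uminus)
  then have cross: "(\<integral>\<omega>. y \<omega> \<bullet> (?S *v w k \<omega>) \<partial>M) = 0" by simp
  have stS: "st (Suc k) \<omega> = y \<omega> + w k \<omega>" for \<omega> by (simp add: st_Suc y_def)
  have S1: "(\<integral>\<omega>. st (Suc k) \<omega> \<bullet> (?S *v st (Suc k) \<omega>) \<partial>M)
    = (\<integral>\<omega>. y \<omega> \<bullet> (?S *v y \<omega>) \<partial>M) + (\<integral>\<omega>. w k \<omega> \<bullet> (?S *v w k \<omega>) \<partial>M)"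
    unfolding stS quadratic_add[OF Ss]
    using square_integrable_quadratic[OF sy sy, of ?S] square_integrable_quadratic[OF sy sw, of ?S]
      square_integrable_quadratic[OF sw sw, of ?S] cross by simp
  have pt: "st k \<omega> \<bullet> (sQ s *v st k \<omega>) + ctl k \<omega> \<bullet> (sR s *v ctl k \<omega>) + y \<omega> \<bullet> (?S *v y \<omega>)
    = st k \<omega> \<bullet> (Sric s T k *v st k \<omega>) + Gam_form s T k 0 (st k \<omega> - est k \<omega> (L + 1))" for \<omega>
    using lqg_complete_square[OF wf k, of "st k \<omega>" "est k \<omega> (L + 1)"]
    by (simp add: y_def ctl_def Gam_form_def)
  have iQ: "integrable M (\<lambda>\<omega>. st k \<omega> \<bullet> (sQ s *v st k \<omega>) + ctl k \<omega> \<bullet> (sR s *v ctl k \<omega>))"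
    by (intro Bochner_Integration.integrable_add square_integrable_quadratic si sc)
  have "(\<integral>\<omega>. st k \<omega> \<bullet> (sQ s *v st k \<omega>) + ctl k \<omega> \<bullet> (sR s *v ctl k \<omega>) \<partial>M) + (\<integral>\<omega>. y \<omega> \<bullet> (?S *v y \<omega>) \<partial>M)
    = (\<integral>\<omega>. st k \<omega> \<bullet> (Sric s T k *v st k \<omega>) + Gam_form s T k 0 (st k \<omega> - est k \<omega> (L + 1)) \<partial>M)"
    unfolding pt[symmetric] using iQ square_integrable_quadratic[OF sy sy, of ?S]
    by (rule Bochner_Integration.integral_add[symmetric])
  also have "\<dots> = (\<integral>\<omega>. st k \<omega> \<bullet> (Sric s T k *v st k \<omega>) \<partial>M) + (\<integral>\<omega>. Gam_form s T k 0 (st k \<omega> - est k \<omega> (L + 1)) \<partial>M)"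
    by (intro Bochner_Integration.integral_add square_integrable_quadratic integrable_Gam_form square_integrable_intros si)
  finally show ?thesis unfolding S1 by simp
qed

lemma control_cost:
  "(\<integral>\<omega>. st T \<omega> \<bullet> (sLam s *v st T \<omega>) + (\<Sum>k<T. st k \<omega> \<bullet> (sQ s *v st k \<omega>) + ctl k \<omega> \<bullet> (sR s *v ctl k \<omega>)) \<partial>M)
   = (\<integral>\<omega>. x0 \<omega> \<bullet> (Sric s T 0 *v x0 \<omega>) \<partial>M) + (\<Sum>k<T. (\<integral>\<omega>. w k \<omega> \<bullet> (Sric s T (Suc k) *v w k \<omega>) \<partial>M))
     + (\<Sum>k<T. (\<integral>\<omega>. Gam_form s T k 0 (st k \<omega> - est k \<omega> (L + 1)) \<partial>M))"
proof -
  let ?q = "\<lambda>k \<omega>. st k \<omega> \<bullet> (sQ s *v st k \<omega>) + ctl k \<omega> \<bullet> (sR s *v ctl k \<omega>)"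
  have si: "square_integrable M (st k)" "square_integrable M (\<lambda>\<omega>. est k \<omega> j)" for k j
    using square_integrable_loop by auto
  have sc: "square_integrable M (ctl k)" for k unfolding ctl_def by (intro square_integrable_intros si)
  have iq: "integrable M (?q k)" for k
    by (intro Bochner_Integration.integrable_add square_integrable_quadratic si sc)
  have "n \<le> T \<Longrightarrow> (\<Sum>k<n. (\<integral>\<omega>. ?q k \<omega> \<partial>M)) + (\<integral>\<omega>. st n \<omega> \<bullet> (Sric s T n *v st n \<omega>) \<partial>M)
    = (\<integral>\<omega>. x0 \<omega> \<bullet> (Sric s T 0 *v x0 \<omega>) \<partial>M) + (\<Sum>k<n. (\<integral>\<omega>. w k \<omega> \<bullet> (Sric s T (Suc k) *v w k \<omega>) \<partial>M))
     + (\<Sum>k<n. (\<integral>\<omega>. Gam_form s T k 0 (st k \<omega> - est k \<omega> (L + 1)) \<partial>M))" for n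
  proof (induction n)
    case 0
    then show ?case by (simp add: st_0)
  next
    case (Suc n)
    then show ?case using control_cost_step[of n] by simp
  qed
  from this[OF order_refl] show ?thesis
    using iq square_integrable_quadratic[OF si(1) si(1), of T "sLam s" T]
    by (simp add: Sric_def)
qed

text \<open>The multiplier is paid exactly when a scheduler transmits and the \<open>kept\<close>
  term exactly when it does not, so they merge into one expectation that can be bounded
  pointwise.\<close>

lemma lagr_cost_eq:
  "lagr_cost M s T L lam sched x0 w v = sched_free_cost M s T L x0 w v
     + (\<Sum>k<T. \<Sum>j<L. (\<integral>\<omega>. (if D k (Suc j) (mis k \<omega> j) then lam (Suc j)
          else Gam_form s T (k + (L - j)) (L - j) (mis k \<omega> j)) \<partial>M))"
proof -
  let ?d = "\<lambda>k j \<omega>. of_bool (D k (Suc j) (mis k \<omega> j)) :: real"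
  have i1: "integrable M (?d k j)" for k j
    by (rule integrable_const_bound[where B=1]) auto
  have comm: "(\<Sum>j\<in>{1..L}. lam j * (\<integral>\<omega>. (\<Sum>k<T. of_bool (cl_delta s T L sched x0 w v k j \<omega>)) \<partial>M))
     = (\<Sum>k<T. \<Sum>j<L. (\<integral>\<omega>. lam (Suc j) * ?d k j \<omega> \<partial>M))"
  proof -
    have "(\<Sum>j\<in>{1..L}. lam j * (\<integral>\<omega>. (\<Sum>k<T. of_bool (cl_delta s T L sched x0 w v k j \<omega>)) \<partial>M))
      = (\<Sum>j<L. lam (Suc j) * (\<integral>\<omega>. (\<Sum>k<T. of_bool (cl_delta s T L sched x0 w v k (Suc j) \<omega>)) \<partial>M))"
      by (rule sum.reindex_bij_witness[of _ Suc "\<lambda>j. j - 1"]) auto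
    also have "\<dots> = (\<Sum>j<L. lam (Suc j) * (\<integral>\<omega>. (\<Sum>k<T. ?d k j \<omega>) \<partial>M))"
      by (simp add: cl_delta_def sched mis_def est_def)
    also have "\<dots> = (\<Sum>j<L. \<Sum>k<T. (\<integral>\<omega>. lam (Suc j) * ?d k j \<omega> \<partial>M))"
      by (simp only: Bochner_Integration.integral_sum[OF i1] sum_distrib_left integral_mult_right_zero)
    finally show ?thesis by (subst (asm) sum.swap)
  qed
  have merge: "kept k j (k + (L - j)) (L - j) + (\<integral>\<omega>. lam (Suc j) * ?d k j \<omega> \<partial>M)
    = (\<integral>\<omega>. (if D k (Suc j) (mis k \<omega> j) then lam (Suc j) else Gam_form s T (k + (L - j)) (L - j) (mis k \<omega> j)) \<partial>M)" for k j
    unfolding kept_def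
    by (subst Bochner_Integration.integral_add[symmetric])
       (auto intro!: integrable_kept_sent i1 Bochner_Integration.integral_cong)
  have stages: "(\<Sum>k<T. (\<integral>\<omega>. Gam_form s T k 0 (st k \<omega> - est k \<omega> (L + 1)) \<partial>M))
    = (\<Sum>k<T. (\<integral>\<omega>. Gam_form s T k 0 (ferr k \<omega>) \<partial>M))
      + (\<Sum>k<T. \<Sum>j<L. (\<integral>\<omega>. Gam_form s T k 0 (mis k \<omega> j) \<partial>M))"
    unfolding stage_decomp by (rule sum.distrib)
  have "lagr_cost M s T L lam sched x0 w v
    = (\<integral>\<omega>. st T \<omega> \<bullet> (sLam s *v st T \<omega>) + (\<Sum>k<T. st k \<omega> \<bullet> (sQ s *v st k \<omega>) + ctl k \<omega> \<bullet> (sR s *v ctl k \<omega>)) \<partial>M)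
      + (\<Sum>k<T. \<Sum>j<L. (\<integral>\<omega>. lam (Suc j) * ?d k j \<omega> \<partial>M))"
    unfolding lagr_cost_def comm by (simp add: st_def ctl_def est_def cl_u_def)
  also have "\<dots> = sched_free_cost M s T L x0 w v
      + ((\<Sum>k<T. \<Sum>j<L. kept k j (k + (L - j)) (L - j)) + (\<Sum>k<T. \<Sum>j<L. (\<integral>\<omega>. lam (Suc j) * ?d k j \<omega> \<partial>M)))"
    unfolding control_cost stages mismatch_cost sched_free_cost_def
    by (simp add: potential_def mis_0)
  finally show ?thesis by (simp only: sum.distrib[symmetric] merge)
qed

end

theorem theorem3:
  fixes M :: "'a measure" and s :: "('n::finite,'m::finite,'p::finite) lqg"
    and x0 :: "'a \<Rightarrow> real^'n" and w :: "nat \<Rightarrow> 'a \<Rightarrow> real^'n" and v :: "nat \<Rightarrow> 'a \<Rightarrow> real^'p"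
    and T L :: nat and lam :: "nat \<Rightarrow> real"
  assumes "lqg_wf s"
    and "lqg_noise M s x0 w v"
    and "1 \<le> L"
    and "\<forall>j\<in>{1..L}. 0 \<le> lam j"
  shows "lagr_cost M s T L lam (dvoi_sched s T L lam) x0 w v
           \<le> lagr_cost M s T L lam periodic_sched x0 w v"
proof -
  \<comment> \<open>The rule as a function of the mismatch error alone; it is even because it sees
    only a quadratic form.\<close>
  define D where "D k j z \<longleftrightarrow> k + (L + 1 - j) \<le> T \<and> lam j - Gam_form s T (k + (L + 1 - j)) (L + 1 - j) z < 0"
    for k j and z :: "real^'n"
  have pM: "prob_space M" using assms(2) by (simp add: lqg_noise_def)
  have even: "Gam_form s T k i (- z) = Gam_form s T k i z" for k i z
    by (simp add: Gam_form_def matrix_vector_mult_uminus)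
  interpret dv: even_scheduling M s x0 w v T L D "dvoi_sched s T L lam"
  proof (intro even_scheduling.intro pM even_scheduling_axioms.intro assms(1,2))
    fix k j z est
    show "D k j (- z) = D k j z" by (simp add: D_def even)
    show "Measurable.pred borel (D k j)" unfolding D_def[abs_def] by measurable
    show "dvoi_sched s T L lam k j est = D k j (est j - est (j + 1))"
      by (simp add: dvoi_sched_def dVoI_def Let_def D_def Gam_form_def inner_mpow_quadratic)
  qed
  interpret per: even_scheduling M s x0 w v T L "\<lambda>_ _ _. True" periodic_sched
    by (intro even_scheduling.intro pM even_scheduling_axioms.intro assms(1,2)) (auto simp: periodic_sched_def)
  have "(\<integral>\<omega>. (if D k (Suc j) (dv.mis k \<omega> j) then lam (Suc j)
          else Gam_form s T (k + (L - j)) (L - j) (dv.mis k \<omega> j)) \<partial>M) \<le> lam (Suc j)"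
    if "j < L" for k j
  proof -
    \<comment> \<open>Silence has two causes. Either the quadratic form is at most the multiplier,
      or its time index lies beyond \<open>T\<close>; then the form is zero, and the sign of the
      multiplier gives the bound.\<close>
    have "0 \<le> lam (Suc j)" using assms(4) that by auto
    then have "(if D k (Suc j) z then lam (Suc j) else Gam_form s T (k + (L - j)) (L - j) z) \<le> lam (Suc j)" for z
      using Gam_form_ge_T[of T "k + (L - j)" s "L - j" z] by (auto simp: D_def)
    then have "(\<integral>\<omega>. (if D k (Suc j) (dv.mis k \<omega> j) then lam (Suc j)
          else Gam_form s T (k + (L - j)) (L - j) (dv.mis k \<omega> j)) \<partial>M) \<le> (\<integral>\<omega>. lam (Suc j) \<partial>M)"
      by (intro integral_mono dv.integrable_kept_sent) auto
    then show ?thesis by (simp add: dv.prob_space)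
  qed
  \<comment> \<open>Under the periodic rule every summand attains its bound.\<close>
  moreover have "(\<integral>\<omega>. (if True then lam (Suc j) else f \<omega>) \<partial>M) = lam (Suc j)" for f j
    by (simp add: dv.prob_space)
  ultimately show ?thesis
    unfolding dv.lagr_cost_eq per.lagr_cost_eq by (auto intro!: sum_mono simp del: sum_constant if_True)
qed

end
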